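(* There is an absolute constant $C$ such that the following holds. Let $K:(-\infty,0)\cup(0,\infty)\to\mathbb{R}$ be an odd, twice differentiable function (in the sense that $K'$ exists and is locally absolutely continuous on $(-\infty,0)\cup(0,\infty)$) which satisfies $$\lim_{x\to\infty}K(x)=\lim_{x\to\infty}K'(x)=0\qquad\text{and}\qquad x^3K''(x)\in L_\infty(\mathbb{R}).$$ Then there exists a (measurable) coefficient function $\gamma:(0,\infty)\to\mathbb{R}$ satisfying $$\|\gamma\|_\infty\le C\,\|x^3K''(x)\|_\infty$$ such that for all real $x\neq y$, $$K(x-y)=\int_{\{0,1\}^{\mathbb{Z}}}\int_1^2\ \sum_{I\in\mathbb{D}_{r,\beta}}\gamma(|I|)\,h_I(x)\,g_I(y)\ \frac{dr}{r}\,d\mathbb{P}(\beta),$$ where the series on the right is absolutely convergent for almost every $(r,\beta)$ (with respect to $\frac{dr}{r}\otimes\mathbb{P}$).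
   Context: Dyadic grids: for $\beta=\{\beta_l\}_{l\in\mathbb{Z}}\in\{0,1\}^{\mathbb{Z}}$ and $r\in[1,2)$, $$\mathbb{D}_{r,\beta}=\Bigl\{\,r2^n\Bigl([0,1)+k+\sum_{i<n}2^{i-n}\beta_i\Bigr)\ :\ n\in\mathbb{Z},\ k\in\mathbb{Z}\Bigr\}.$$ $|I|$ denotes the length of the interval $I$. $\mathbb{P}$ is the uniform product probability measure on $\{0,1\}^{\mathbb{Z}}$: the coordinates $\beta_l$ are independent with $\mathbb{P}(\beta_l=0)=\mathbb{P}(\beta_l=1)=\frac12$. The functions $h,g:\mathbb{R}\to\mathbb{R}$ vanish outside $[0,1)$, and are given on $[0,1)$ by $$h=7\ \text{on}\ [0,\tfrac14),\quad h=-1\ \text{on}\ [\tfrac14,\tfrac12),\quad h=1\ \text{on}\ [\tfrac12,\tfrac34),\quad h=-7\ \text{on}\ [\tfrac34,1),$$ $$g=-1\ \text{on}\ [0,\tfrac14),\quad g=1\ \text{on}\ [\tfrac14,\tfrac34),\quad g=-1\ \text{on}\ [\tfrac34,1).$$ For a function $f$ on $\mathbb{R}$ and an interval $I$ with left endpoint $a$ and length $l$, $f_I(x)=\frac{1}{\sqrt{l}}f\left(\frac{x-a}{l}\right)$. Here $\|\cdot\|_\infty$ is the essential supremum norm, and $K''$ is the almost everywhere defined derivative of $K'$. *)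

theory Defs
  imports "HOL-Probability.Probability"
begin

(* The intervals [r 2^n (k + s), r 2^n (1 + k + s)), s = sum_{i<n} 2^(i-n) \<beta> i, as sets of reals.
   For \<beta> with values in {0,1} the series s converges absolutely, so infsum is its value. *)
definition dyadic_grid :: "real \<Rightarrow> (int \<Rightarrow> nat) \<Rightarrow> real set set" where
  "dyadic_grid r \<beta> =
     {(\<lambda>t. r * 2 powi n * (t + of_int k + (\<Sum>\<^sub>\<infinity>i\<in>{..<n}. 2 powi (i - n) * real (\<beta> i)))) ` {0..<1}
      | n k :: int. True}"

definition shift_measure :: "(int \<Rightarrow> nat) measure" where
  "shift_measure = Pi\<^sub>M UNIV (\<lambda>_. uniform_count_measure {0, 1})"

definition dilation_measure :: "real measure" where
  "dilation_measure = density (lebesgue_on {1..<2}) (\<lambda>r. ennreal (1 / r))"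

definition h :: "real \<Rightarrow> real" where
  "h x = (if 0 \<le> x \<and> x < 1/4 then 7
          else if 1/4 \<le> x \<and> x < 1/2 then -1
          else if 1/2 \<le> x \<and> x < 3/4 then 1
          else if 3/4 \<le> x \<and> x < 1 then -7
          else 0)"

definition g :: "real \<Rightarrow> real" where
  "g x = (if 0 \<le> x \<and> x < 1/4 then -1
          else if 1/4 \<le> x \<and> x < 3/4 then 1
          else if 3/4 \<le> x \<and> x < 1 then -1
          else 0)"

(* Inf I is the left endpoint and measure lborel I the length of a bounded interval I. *)
definition rescaled :: "(real \<Rightarrow> real) \<Rightarrow> real set \<Rightarrow> real \<Rightarrow> real" where
  "rescaled f I x = 1 / sqrt (measure lborel I) * f ((x - Inf I) / measure lborel I)"

(* The value is \<infinity> if the function is not essentially bounded or not measurable. *)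
definition Linf_norm :: "'a measure \<Rightarrow> ('a \<Rightarrow> real) \<Rightarrow> ereal" where
  "Linf_norm M f = esssup M (\<lambda>x. ereal \<bar>f x\<bar>)"

(* D ranges over the finite families of compact intervals with pairwise disjoint interiors
   contained in S. *)
definition absolutely_continuous_on :: "real set \<Rightarrow> (real \<Rightarrow> real) \<Rightarrow> bool" where
  "absolutely_continuous_on S f \<longleftrightarrow>
     (\<forall>\<epsilon>>0. \<exists>\<delta>>0. \<forall>D. D division_of \<Union>D \<longrightarrow> \<Union>D \<subseteq> S \<longrightarrow> (\<Sum>I\<in>D. Sup I - Inf I) < \<delta> \<longrightarrow>
        (\<Sum>I\<in>D. \<bar>f (Sup I) - f (Inf I)\<bar>) < \<epsilon>)"

definition locally_absolutely_continuous_on :: "real set \<Rightarrow> (real \<Rightarrow> real) \<Rightarrow> bool" where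
  "locally_absolutely_continuous_on S f \<longleftrightarrow>
     (\<forall>a b. {a..b} \<subseteq> S \<longrightarrow> absolutely_continuous_on {a..b} f)"

definition grid_term ::
    "(real \<Rightarrow> real) \<Rightarrow> real \<Rightarrow> real \<Rightarrow> real set \<Rightarrow> real" where
  "grid_term \<gamma> x y I = \<gamma> (measure lborel I) * rescaled h I x * rescaled g I y"

end

theory Submission
  imports Defs
begin

text \<open>
  For a fixed scale the random translation is uniformly distributed on \<open>[0, 1]\<close>, so averaging
  \<open>h\<^sub>I(x) g\<^sub>I(y)\<close> over all intervals of length \<open>l\<close> gives \<open>\<phi>((x - y) / l) / l\<close>, where \<open>\<phi>\<close> is the
  correlation of \<open>h\<close> and \<open>g\<close>. Averaging over the dilations then turns the right-hand side into
  \<open>\<integral> \<gamma>(l) \<phi>((x - y) / l) l\<^sup>-\<^sup>2 dl\<close> over \<open>(0, \<infinity>)\<close>. The odd function \<open>\<phi>\<close> is piecewise linear; on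
  \<open>(0, \<infinity>)\<close> it is \<open>\<Sum> a (c - u)\<^sub>+\<close> with \<open>(c, a) = (1/4, 2), (1/2, 18), (3/4, -22), (1, 7)\<close>, while
  \<open>K(u) = \<integral> (t - u)\<^sub>+ K''(t) dt\<close>. Substituting \<open>t = c l\<close> in each summand, it suffices that
  \<open>\<Sum> a c\<^sup>2 \<gamma>(t / c) = t\<^sup>3 K''(t)\<close>. The coefficient \<open>-99/8\<close> belonging to \<open>c = 3/4\<close> exceeds the sum
  \<open>93/8\<close> of the other coefficients in absolute value, so a Neumann series solves this equation
  with \<open>\<bar>\<gamma>\<bar> \<le> 4/3 \<parallel>t\<^sup>3 K''\<parallel>\<close>.
\<close>

text \<open>The obstacle on the analytic side is that \<open>deriv (deriv K)\<close> is meaningful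
  only almost everywhere. The moment formula for \<open>K\<close> therefore rests on the fundamental
  theorem of calculus for absolutely continuous functions, and this on Lebesgue's theorem that
  monotone functions are differentiable almost everywhere, by way of a Vitali covering argument. The
  correlation is odd because \<open>h\<close> is odd and \<open>g\<close> is even about 1/2, up to
  endpoints. In the variable log t the equation for \<gamma> is a convolution equation with four
  point masses. Sup norms alone solve it as soon as one mass outweighs the others together; the
  steps 7 and 1 of \<open>h\<close> achieve this with margin 99/8 - 93/8 = 3/4, whence the constant
  4/3. The exchange of the sum with the two integrals is governed by one observation: for x \<noteq>
  y a term vanishes unless |I| > |x - y|, and each scale contributes O(1/|I|). A geometric series
  thus dominates the sum uniformly in \<open>r\<close> and \<beta>.\<close>

section \<open>Almost everywhere differentiability of absolutely continuous functions\<close>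

text \<open>The Vitali theorem for closed balls leaves out a null set, passing to open intervals
  loses only countably many endpoints, and continuity of the measure from below cuts the family down
  to a finite one at the cost of \<open>e\<close>. Open intervals are kept so that a second covering
  can be placed inside the first.\<close>

lemma Vitali_finite_subcover:
  fixes E :: "real set" and P :: "real \<Rightarrow> real \<Rightarrow> bool"
  assumes E: "E \<in> lmeasurable" and e: "0 < e"
    and fine: "\<And>x d. x \<in> E \<Longrightarrow> 0 < d \<Longrightarrow> \<exists>u v. u < x \<and> x < v \<and> v - u < d \<and> P u v"
  obtains C where "finite C" "\<And>u v. (u, v) \<in> C \<Longrightarrow> u < v \<and> P u v"
    "pairwise (\<lambda>(u, v) (u', v'). disjnt {u..v} {u'..v'}) C"
    "measure lebesgue E - e < measure lebesgue (E \<inter> (\<Union>(u, v)\<in>C. {u<..<v}))"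
proof -
  define K where "K = {(u, v). u < v \<and> P u v}"
  define a where "a = (\<lambda>(u, v). (u + v) / 2 :: real)"
  define r where "r = (\<lambda>(u, v). (v - u) / 2 :: real)"
  have cball: "cball (a p) (r p) = {fst p..snd p}" for p
    by (cases p) (auto simp: a_def r_def cball_eq_atLeastAtMost field_simps)
  have r: "0 < r i" if "i \<in> K" for i
    using that by (auto simp: K_def r_def)
  have S: "\<exists>i. i \<in> K \<and> x \<in> cball (a i) (r i) \<and> r i < d" if x: "x \<in> E" and d: "0 < d" for x d
  proof -
    obtain u v where uv: "u < x" "x < v" "v - u < d" "P u v"
      using fine[OF x d] by auto
    then have "(u, v) \<in> K" "x \<in> cball (a (u, v)) (r (u, v))" "r (u, v) < d"
      unfolding cball by (auto simp: K_def r_def)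
    then show ?thesis by blast
  qed
  obtain C where C: "countable C" "C \<subseteq> K"
     "pairwise (\<lambda>i j. disjnt (cball (a i) (r i)) (cball (a j) (r j))) C"
     "negligible (E - (\<Union>i \<in> C. cball (a i) (r i)))"
    using Vitali_covering_theorem_cballs[of K r E a, OF r S] by blast
  define O' where "O' p = {fst p<..<snd p}" for p :: "real \<times> real"
  have neg: "negligible (E - (\<Union>i\<in>C. O' i))"
  proof (rule negligible_subset)
    show "negligible ((E - (\<Union>i \<in> C. cball (a i) (r i))) \<union> (\<Union>i\<in>C. {fst i, snd i}))"
      using C by (intro negligible_Un negligible_countable_Union) auto
    show "E - (\<Union>i\<in>C. O' i) \<subseteq> (E - (\<Union>i \<in> C. cball (a i) (r i))) \<union> (\<Union>i\<in>C. {fst i, snd i})"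
      unfolding cball O'_def by fastforce
  qed
  show thesis
  proof (cases "C = {}")
    case True
    then have "measure lebesgue E = 0" using neg
      by (simp add: negligible_imp_measure0)
    then show thesis using e by (intro that[of "{}"]) auto
  next
    case False
    define f where "f = from_nat_into C"
    have f: "range f = C" unfolding f_def using C(1) False by (simp add: range_from_nat_into)
    define A where "A n = E \<inter> (\<Union>i<n. O' (f i))" for n
    have Am: "A n \<in> sets lebesgue" for n
      unfolding A_def O'_def using E by (intro sets.Int sets.finite_UN) (auto simp: fmeasurableD)
    have "(\<lambda>n. measure lebesgue (A n)) \<longlonglongrightarrow> measure lebesgue (\<Union>n. A n)"
    proof (rule Lim_measure_incseq)
      show "range A \<subseteq> sets lebesgue" using Am by auto
      show "incseq A" unfolding A_def incseq_def by fastforce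
      have "(\<Union>n. A n) \<subseteq> E" unfolding A_def by auto
      then have "emeasure lebesgue (\<Union>n. A n) \<le> emeasure lebesgue E"
        using E by (intro emeasure_mono) (auto simp: fmeasurableD)
      then show "emeasure lebesgue (\<Union>n. A n) \<noteq> \<infinity>"
        using E by (auto simp: fmeasurable_def)
    qed
    moreover have "measure lebesgue (\<Union>n. A n) = measure lebesgue E"
    proof (rule measure_negligible_symdiff)
      show "E \<in> lmeasurable" by (rule E)
      have U: "(\<Union>n. A n) = E \<inter> (\<Union>i\<in>C. O' i)"
        unfolding A_def f[symmetric] by auto
      have "sym_diff E (\<Union>n. A n) = E - (\<Union>i\<in>C. O' i)" unfolding U by auto
      then show "negligible (sym_diff E (\<Union>n. A n))" using neg by simp
    qed
    ultimately have "\<forall>\<^sub>F n in sequentially. measure lebesgue E - e < measure lebesgue (A n)"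
      using e by (auto intro: order_tendstoD)
    then obtain n where n: "measure lebesgue E - e < measure lebesgue (A n)"
      by (auto simp: eventually_sequentially)
    show thesis
    proof (rule that[of "f ` {..<n}"])
      have sub: "f ` {..<n} \<subseteq> C" using f by auto
      show "u < v \<and> P u v" if "(u, v) \<in> f ` {..<n}" for u v
        using that sub C(2) by (auto simp: K_def)
      show "pairwise (\<lambda>(u, v) (u', v'). disjnt {u..v} {u'..v'}) (f ` {..<n})"
        using pairwise_subset[OF C(3) sub] unfolding cball by (simp add: case_prod_beta' pairwise_def)
      have "E \<inter> (\<Union>(u, v)\<in>f ` {..<n}. {u<..<v}) = A n"
        by (auto simp: A_def O'_def case_prod_beta')
      then show "measure lebesgue E - e < measure lebesgue (E \<inter> (\<Union>(u, v)\<in>f ` {..<n}. {u<..<v}))"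
        using n by simp
    qed auto
  qed
qed

text \<open>Induction by removing the interval with the largest right endpoint: by disjointness the
  others end before its left endpoint \<open>u\<close>, so the hypothesis applies on
  \<open>{c..u}\<close>.\<close>

lemma sum_mono_increments_le:
  fixes F :: "real \<Rightarrow> real"
  assumes "finite C" and "mono_on {c..d} F" and "c \<le> d"
    and "\<And>u v. (u, v) \<in> C \<Longrightarrow> c \<le> u \<and> u < v \<and> v \<le> d"
    and "pairwise (\<lambda>(u, v) (u', v'). disjnt {u..v} {u'..v'}) C"
  shows "(\<Sum>(u, v)\<in>C. F v - F u) \<le> F d - F c"
  using assms
proof (induction "card C" arbitrary: C d)
  case 0
  then have "C = {}" by simp
  then show ?case using monotone_onD[OF "0.prems"(2), of c d] "0.prems" by auto
next
  case (Suc n)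
  have "C \<noteq> {}" using Suc by auto
  then have "Max (snd ` C) \<in> snd ` C" using Suc.prems by (intro Max_in) auto
  then obtain u v where uv: "(u, v) \<in> C" "v = Max (snd ` C)" by auto
  have mx: "v' \<le> v" if "(u', v') \<in> C" for u' v'
    unfolding uv(2) using that Suc.prems(1) by (intro Max_ge) force+
  have b: "c \<le> u" "u < v" "v \<le> d" using Suc.prems(4) uv by auto
  have "(\<Sum>(u, v)\<in>C - {(u, v)}. F v - F u) \<le> F u - F c"
  proof (rule Suc.hyps(1))
    show "n = card (C - {(u, v)})" using Suc uv by simp
    show "finite (C - {(u, v)})" using Suc by simp
    show "mono_on {c..u} F" using Suc.prems(2) b by (auto intro: monotone_on_subset)
    show "c \<le> u" by fact
    show "c \<le> u' \<and> u' < v' \<and> v' \<le> u" if "(u', v') \<in> C - {(u, v)}" for u' v'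
    proof -
      have "disjnt {u..v} {u'..v'}" using pairwiseD[OF Suc.prems(5) uv(1), of "(u', v')"] that by auto
      moreover have "v' \<le> v" "u' < v'" "c \<le> u'" using that mx Suc.prems(4) by auto
      moreover have "v' < u"
      proof (rule ccontr)
        assume "\<not> v' < u"
        then have "v' \<in> {u..v} \<inter> {u'..v'}" using \<open>v' \<le> v\<close> \<open>u' < v'\<close> by auto
        then show False using \<open>disjnt _ _\<close> by (auto simp: disjnt_def)
      qed
      ultimately show ?thesis by auto
    qed
    show "pairwise (\<lambda>(u, v) (u', v'). disjnt {u..v} {u'..v'}) (C - {(u, v)})"
      using Suc.prems(5) by (rule pairwise_subset) auto
  qed
  moreover have "(\<Sum>(u, v)\<in>C. F v - F u) = F v - F u + (\<Sum>(u, v)\<in>C - {(u, v)}. F v - F u)"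
    using sum.remove[OF Suc.prems(1) uv(1), of "\<lambda>(u, v). F v - F u"] by simp
  moreover have "F v \<le> F d" using monotone_onD[OF Suc.prems(2), of v d] b by auto
  ultimately show ?case by simp
qed

text \<open>It suffices to let \<open>d\<close> run through the numbers 1/(n+1), and for each of
  them the points form a union of open intervals. The set is thus a G-delta, whatever
  \<open>P\<close> is.\<close>

lemma sets_fine_cover:
  "{x::real. \<forall>d>0. \<exists>u v. u < x \<and> x < v \<and> v - u < d \<and> P u v} \<in> sets borel"
proof -
  have "{x. \<forall>d>0. \<exists>u v. u < x \<and> x < v \<and> v - u < d \<and> P u v} =
      (\<Inter>n. \<Union>(u, v)\<in>{(u, v). v - u < inverse (real (Suc n)) \<and> P u v}. {u<..<v})" (is "?L = ?R")
  proof
    show "?L \<subseteq> ?R"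
    proof
      fix x assume x: "x \<in> ?L"
      show "x \<in> ?R"
      proof
        fix n :: nat
        obtain u v where "u < x \<and> x < v \<and> v - u < inverse (real (Suc n)) \<and> P u v"
          using x inverse_Suc[of n] by blast
        then show "x \<in> (\<Union>(u, v)\<in>{(u, v). v - u < inverse (real (Suc n)) \<and> P u v}. {u<..<v})" by auto
      qed
    qed
    show "?R \<subseteq> ?L"
    proof
      fix x assume x: "x \<in> ?R"
      have "\<exists>u v. u < x \<and> x < v \<and> v - u < d \<and> P u v" if d: "d > 0" for d
      proof -
        obtain n where n: "inverse (real (Suc n)) < d" using reals_Archimedean[OF d] by auto
        have "x \<in> (\<Union>(u, v)\<in>{(u, v). v - u < inverse (real (Suc n)) \<and> P u v}. {u<..<v})"
          using x by blast
        then show ?thesis using n by fastforce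
      qed
      then show "x \<in> ?L" by auto
    qed
  qed
  also have "\<dots> \<in> sets borel"
    by (intro sets.countable_INT'' borel_open open_UN) auto
  finally show ?thesis .
qed

lemma sum_disjnt_lengths_le:
  fixes U :: "real set"
  assumes "finite C" and "\<And>u v. (u, v) \<in> C \<Longrightarrow> u \<le> v \<and> {u..v} \<subseteq> U"
    and "pairwise (\<lambda>(u, v) (u', v'). disjnt {u..v} {u'..v'}) C" and U: "U \<in> lmeasurable"
  shows "(\<Sum>(u, v)\<in>C. v - u) \<le> measure lebesgue U"
proof -
  have "(\<Sum>(u, v)\<in>C. v - u) = (\<Sum>p\<in>C. measure lebesgue {fst p..snd p})"
    using assms(2) by (intro sum.cong) auto
  also have "\<dots> = measure lebesgue (\<Union>p\<in>C. {fst p..snd p})"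
    using assms(3) by (intro measure_finite_Union[symmetric] assms(1))
      (auto simp: disjoint_family_on_def pairwise_def disjnt_def case_prod_beta' emeasure_lborel_Icc_eq)
  also have "\<dots> \<le> measure lebesgue U"
  proof (rule measure_mono_fmeasurable[OF _ _ U])
    show "(\<Union>p\<in>C. {fst p..snd p}) \<subseteq> U" using assms(2) by fastforce
    show "(\<Union>p\<in>C. {fst p..snd p}) \<in> sets lebesgue" using assms(1) by (intro sets.finite_UN) auto
  qed
  finally show ?thesis .
qed

lemma measure_Int_le_sum_lengths:
  fixes E :: "real set"
  assumes "finite C" and "\<And>u v. (u, v) \<in> C \<Longrightarrow> u \<le> v" and "E \<in> sets lebesgue"
  shows "measure lebesgue (E \<inter> (\<Union>(u, v)\<in>C. {u<..<v})) \<le> (\<Sum>(u, v)\<in>C. v - u)"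
proof -
  have "measure lebesgue (E \<inter> (\<Union>(u, v)\<in>C. {u<..<v})) \<le> measure lebesgue (\<Union>p\<in>C. {fst p<..<snd p})"
    using assms by (intro measure_mono_fmeasurable fmeasurable.finite_UN sets.Int sets.finite_UN) auto
  also have "\<dots> \<le> (\<Sum>p\<in>C. measure lebesgue {fst p<..<snd p})"
    using assms(1) by (intro measure_UNION_le) auto
  also have "\<dots> = (\<Sum>(u, v)\<in>C. v - u)"
    using assms(2) by (intro sum.cong) auto
  finally show ?thesis .
qed

text \<open>
  The difference quotients are taken over intervals with \<open>x\<close> in the interior: the points admitting
  such intervals form an open set, so that no outer measures are needed. One-sided quotients are
  recovered at the points of continuity, which are all but countably many.
\<close>

definition upper_fine :: "(real \<Rightarrow> real) \<Rightarrow> real \<Rightarrow> real \<Rightarrow> real \<Rightarrow> real set" where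
  "upper_fine F a b q = {x. \<forall>d>0. \<exists>u v. u < x \<and> x < v \<and> v - u < d \<and>
      (a \<le> u \<and> v \<le> b \<and> q * (v - u) < F v - F u)}"

definition lower_fine :: "(real \<Rightarrow> real) \<Rightarrow> real \<Rightarrow> real \<Rightarrow> real \<Rightarrow> real set" where
  "lower_fine F a b p = {x. \<forall>d>0. \<exists>u v. u < x \<and> x < v \<and> v - u < d \<and>
      (a \<le> u \<and> v \<le> b \<and> F v - F u < p * (v - u))}"

lemma fine_subset: "upper_fine F a b q \<subseteq> {a..b}" "lower_fine F a b p \<subseteq> {a..b}"
proof -
  have "x \<in> {a..b}" if "x \<in> upper_fine F a b q \<or> x \<in> lower_fine F a b p" for x
  proof -
    from that obtain u v where "u < x" "x < v" "a \<le> u" "v \<le> b"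
      unfolding upper_fine_def lower_fine_def using zero_less_one[where 'a=real] by blast
    then show ?thesis by simp
  qed
  then show "upper_fine F a b q \<subseteq> {a..b}" "lower_fine F a b p \<subseteq> {a..b}" by blast+
qed

lemma fine_lmeasurable: "upper_fine F a b q \<in> lmeasurable"
  "upper_fine F a b q \<inter> lower_fine F a b p \<in> lmeasurable"
proof -
  have *: "upper_fine F a b q \<in> sets lebesgue" "lower_fine F a b p \<in> sets lebesgue"
    unfolding upper_fine_def lower_fine_def by (rule sets_completionI_sets[of _ lborel, unfolded sets_lborel, OF sets_fine_cover])+
  show "upper_fine F a b q \<in> lmeasurable" "upper_fine F a b q \<inter> lower_fine F a b p \<in> lmeasurable"
    using * fine_subset[of F a b] by (auto intro!: bounded_set_imp_lmeasurable sets.Int bounded_subset[OF bounded_closed_interval[of a b]])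
qed

text \<open>Disjoint intervals of slope above \<open>q\<close> that nearly exhaust the set have
  total growth at least \<open>q\<close> times their length, while monotonicity allows at most
  \<open>F b - F a\<close>.\<close>

lemma measure_upper_fine_le:
  assumes F: "mono_on {a..b} F" and ab: "a \<le> b" and q: "0 < q"
  shows "q * measure lebesgue (upper_fine F a b q) \<le> F b - F a"
proof (rule field_le_epsilon)
  fix e :: real assume e: "0 < e"
  let ?E = "upper_fine F a b q"
  have "0 < e / q" using e q by simp
  obtain C where C: "finite C"
    "\<And>u v. (u, v) \<in> C \<Longrightarrow> u < v \<and> (a \<le> u \<and> v \<le> b \<and> q * (v - u) < F v - F u)"
    "pairwise (\<lambda>(u, v) (u', v'). disjnt {u..v} {u'..v'}) C"
    "measure lebesgue ?E - e / q < measure lebesgue (?E \<inter> (\<Union>(u, v)\<in>C. {u<..<v}))"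
    by (rule Vitali_finite_subcover[OF fine_lmeasurable(1) \<open>0 < e / q\<close>,
        of F a b q "\<lambda>u v. a \<le> u \<and> v \<le> b \<and> q * (v - u) < F v - F u"])
      (auto simp: upper_fine_def)
  have "measure lebesgue ?E - e / q \<le> (\<Sum>(u, v)\<in>C. v - u)"
    using C(4) measure_Int_le_sum_lengths[OF C(1), of ?E] C(2) fine_lmeasurable(1)[of F a b q]
    by (force dest: fmeasurableD)
  then have "q * measure lebesgue ?E - e \<le> q * (\<Sum>(u, v)\<in>C. v - u)"
    using q by (simp add: field_simps)
  also have "\<dots> = (\<Sum>(u, v)\<in>C. q * (v - u))" by (simp add: sum_distrib_left case_prod_beta')
  also have "\<dots> \<le> (\<Sum>(u, v)\<in>C. F v - F u)" using C(2) by (intro sum_mono) force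
  also have "\<dots> \<le> F b - F a" using C by (intro sum_mono_increments_le F ab) auto
  finally show "q * measure lebesgue ?E \<le> F b - F a + e" by simp
qed

text \<open>A double covering: \<open>C1\<close> consists of intervals of slope below
  \<open>p\<close> inside an open \<open>U\<close> of nearly the measure of the set, and
  \<open>C2\<close> of intervals of slope above \<open>q\<close>, each inside a member of
  \<open>C1\<close>. Grouping \<open>C2\<close> by its containers (\<open>J\<close>) compares both
  growths: q times the length of \<open>C2\<close> is at most the growth over \<open>C1\<close>,
  hence at most p times the measure of \<open>U\<close>. For p < q this forces measure zero.\<close>

lemma measure_fine_Int:
  assumes F: "mono_on {a..b} F" and p: "0 \<le> p" and q: "0 < q"
  shows "q * measure lebesgue (upper_fine F a b q \<inter> lower_fine F a b p)
      \<le> p * measure lebesgue (upper_fine F a b q \<inter> lower_fine F a b p)"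
proof (rule field_le_epsilon)
  define E where "E = upper_fine F a b q \<inter> lower_fine F a b p"
  fix e' :: real assume e': "0 < e'"
  \<comment> \<open>The losses are \<open>p * e\<close> from enlarging the set to \<open>U\<close>
    and \<open>q * e\<close> from each of the two coverings.\<close>
  define e where "e = e' / (p + 2 * q)"
  have e: "0 < e" using p q e' by (simp add: e_def)
  have E: "E \<in> lmeasurable" unfolding E_def by (rule fine_lmeasurable)
  obtain U where U: "open U" "E \<subseteq> U" "U \<in> lmeasurable" "measure lebesgue U < measure lebesgue E + e"
  proof -
    obtain T where T: "open T" "E \<subseteq> T" "T - E \<in> lmeasurable" "emeasure lebesgue (T - E) < ennreal e"
      using sets_lebesgue_outer_open[OF fmeasurableD[OF E] e] by blast
    have "T = E \<union> (T - E)" using T by auto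
    then have "T \<in> lmeasurable" using fmeasurable.Un[OF E T(3)] by simp
    moreover have "measure lebesgue (T - E) < e"
      using T(3,4) e by (simp add: emeasure_eq_measure2 ennreal_less_iff)
    then have "measure lebesgue T < measure lebesgue E + e"
      using measure_Un3[OF E T(3)] \<open>T = E \<union> (T - E)\<close> by (simp add: Int_Diff)
    ultimately show thesis using T that by blast
  qed
  obtain C1 where C1: "finite C1"
    "\<And>u v. (u, v) \<in> C1 \<Longrightarrow> u < v \<and> ({u..v} \<subseteq> U \<and> a \<le> u \<and> v \<le> b \<and> F v - F u < p * (v - u))"
    "pairwise (\<lambda>(u, v) (u', v'). disjnt {u..v} {u'..v'}) C1"
    "measure lebesgue E - e < measure lebesgue (E \<inter> (\<Union>(u, v)\<in>C1. {u<..<v}))"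
  proof (rule Vitali_finite_subcover[OF E e,
        of "\<lambda>u v. {u..v} \<subseteq> U \<and> a \<le> u \<and> v \<le> b \<and> F v - F u < p * (v - u)"])
    fix x d :: real assume x: "x \<in> E" and d: "0 < d"
    then obtain d' where d': "d' > 0" "ball x d' \<subseteq> U" using U openE by blast
    have "0 < min d d'" using d d' by simp
    then obtain u v where uv: "u < x" "x < v" "v - u < min d d'" "a \<le> u \<and> v \<le> b \<and> F v - F u < p * (v - u)"
      using x unfolding E_def lower_fine_def by blast
    then have "{u..v} \<subseteq> ball x d'" by (auto simp: dist_real_def)
    then show "\<exists>u v. u < x \<and> x < v \<and> v - u < d \<and> {u..v} \<subseteq> U \<and> a \<le> u \<and> v \<le> b \<and> F v - F u < p * (v - u)"
      using uv d' by fastforce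
  qed (rule that; blast)
  define E1 where "E1 = E \<inter> (\<Union>(u, v)\<in>C1. {u<..<v})"
  have E1: "E1 \<in> lmeasurable" unfolding E1_def
    using E C1(1) by (intro fmeasurable_Int_fmeasurable sets.finite_UN) auto
  let ?P = "\<lambda>u v. (\<exists>(u', v')\<in>C1. u' \<le> u \<and> v \<le> v') \<and> q * (v - u) < F v - F u"
  obtain C2 where C2: "finite C2" "\<And>u v. (u, v) \<in> C2 \<Longrightarrow> u < v \<and> ?P u v"
    "pairwise (\<lambda>(u, v) (u', v'). disjnt {u..v} {u'..v'}) C2"
    "measure lebesgue E1 - e < measure lebesgue (E1 \<inter> (\<Union>(u, v)\<in>C2. {u<..<v}))"
  proof (rule Vitali_finite_subcover[OF E1 e, of ?P])
    fix x d :: real assume x: "x \<in> E1" and d: "0 < d"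
    then obtain u' v' where u': "(u', v') \<in> C1" "u' < x" "x < v'" by (auto simp: E1_def)
    define d' where "d' = min d (min (x - u') (v' - x))"
    have "0 < d'" using u' d by (auto simp: d'_def)
    then obtain u v where uv: "u < x" "x < v" "v - u < d'" "q * (v - u) < F v - F u"
      using x unfolding E1_def E_def upper_fine_def by blast
    then have "u' \<le> u" "v \<le> v'" "v - u < d" by (auto simp: d'_def)
    then show "\<exists>u v. u < x \<and> x < v \<and> v - u < d \<and> ?P u v" using uv u' by blast
  qed (rule that; blast)
  have "\<forall>i\<in>C2. \<exists>j\<in>C1. fst j \<le> fst i \<and> snd i \<le> snd j"
  proof (rule ballI)
    fix i assume "i \<in> C2"
    then have "\<exists>(u', v')\<in>C1. u' \<le> fst i \<and> snd i \<le> v'" using C2(2)[of "fst i" "snd i"] by auto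
    then show "\<exists>j\<in>C1. fst j \<le> fst i \<and> snd i \<le> snd j" by (simp add: split_beta)
  qed
  then obtain J where J: "\<And>i. i \<in> C2 \<Longrightarrow> J i \<in> C1 \<and> fst (J i) \<le> fst i \<and> snd i \<le> snd (J i)"
    by metis
  have "measure lebesgue E - 2 * e \<le> measure lebesgue (E1 \<inter> (\<Union>(u, v)\<in>C2. {u<..<v}))"
    using C2(4) C1(4) unfolding E1_def by simp
  also have "\<dots> \<le> (\<Sum>(u, v)\<in>C2. v - u)"
    using C2(2) E1 by (intro measure_Int_le_sum_lengths C2(1)) (auto dest: less_imp_le)
  finally have "q * (measure lebesgue E - 2 * e) \<le> q * (\<Sum>(u, v)\<in>C2. v - u)"
    using q by simp
  also have "\<dots> = (\<Sum>(u, v)\<in>C2. q * (v - u))" by (simp add: sum_distrib_left case_prod_beta')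
  also have "\<dots> \<le> (\<Sum>(u, v)\<in>C2. F v - F u)" using C2(2) by (intro sum_mono) force
  also have "\<dots> = (\<Sum>j\<in>C1. (\<Sum>(u, v)\<in>{i\<in>C2. J i = j}. F v - F u))"
    using J by (intro sum.group[symmetric] C1 C2) auto
  also have "\<dots> \<le> (\<Sum>j\<in>C1. F (snd j) - F (fst j))"
  proof (rule sum_mono)
    fix j assume j: "j \<in> C1"
    have j': "fst j < snd j" "a \<le> fst j" "snd j \<le> b" using C1(2)[of "fst j" "snd j"] j by auto
    show "(\<Sum>(u, v)\<in>{i\<in>C2. J i = j}. F v - F u) \<le> F (snd j) - F (fst j)"
    proof (rule sum_mono_increments_le)
      show "finite {i \<in> C2. J i = j}" using C2 by simp
      show "mono_on {fst j..snd j} F" using F j' by (auto intro: monotone_on_subset)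
      show "fst j \<le> snd j" using j' by simp
      show "fst j \<le> u \<and> u < v \<and> v \<le> snd j" if "(u, v) \<in> {i \<in> C2. J i = j}" for u v
        using that J[of "(u, v)"] C2(2)[of u v] by auto
      show "pairwise (\<lambda>(u, v) (u', v'). disjnt {u..v} {u'..v'}) {i \<in> C2. J i = j}"
        using C2(3) by (rule pairwise_subset) auto
    qed
  qed
  also have "\<dots> \<le> (\<Sum>j\<in>C1. p * (snd j - fst j))" using C1(2) by (intro sum_mono) force
  also have "\<dots> = p * (\<Sum>(u, v)\<in>C1. v - u)" by (simp add: sum_distrib_left case_prod_beta')
  also have "\<dots> \<le> p * measure lebesgue U"
    using C1 by (intro mult_left_mono p sum_disjnt_lengths_le U) (auto dest: less_imp_le)
  also have "\<dots> \<le> p * (measure lebesgue E + e)" using U(4) p by (intro mult_left_mono) auto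
  finally have "q * measure lebesgue E \<le> p * measure lebesgue E + (p + 2 * q) * e"
    by (simp add: algebra_simps)
  also have "(p + 2 * q) * e = e'" using p q by (simp add: e_def)
  finally show "q * measure lebesgue (upper_fine F a b q \<inter> lower_fine F a b p)
      \<le> p * measure lebesgue (upper_fine F a b q \<inter> lower_fine F a b p) + e'"
    unfolding E_def .
qed


lemma negligible_fine_Int:
  assumes F: "mono_on {a..b} F" and pq: "p < q"
  shows "negligible (upper_fine F a b q \<inter> lower_fine F a b p)"
proof (cases "0 \<le> p")
  case True
  have "q * measure lebesgue (upper_fine F a b q \<inter> lower_fine F a b p)
      \<le> p * measure lebesgue (upper_fine F a b q \<inter> lower_fine F a b p)"
    using measure_fine_Int[OF F True] True pq by simp
  then have "(q - p) * measure lebesgue (upper_fine F a b q \<inter> lower_fine F a b p) \<le> 0"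
    by (simp add: algebra_simps)
  then have "measure lebesgue (upper_fine F a b q \<inter> lower_fine F a b p) = 0"
    using pq measure_nonneg[of lebesgue "upper_fine F a b q \<inter> lower_fine F a b p"]
    by (simp add: mult_le_0_iff)
  then show ?thesis using fine_lmeasurable(2)[of F a b q p] by (simp add: negligible_iff_measure)
next
  case False
  \<comment> \<open>With \<open>p\<close> negative, a slope below \<open>p\<close> would contradict
    monotonicity.\<close>
  have "lower_fine F a b p = {}"
  proof -
    have "x \<notin> lower_fine F a b p" for x
    proof
      assume "x \<in> lower_fine F a b p"
      then obtain u v where uv: "u < x" "x < v" "a \<le> u" "v \<le> b" "F v - F u < p * (v - u)"
        unfolding lower_fine_def using zero_less_one[where 'a=real] by blast
      have "F u \<le> F v" using uv by (intro monotone_onD[OF F]) auto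
      moreover have "p * (v - u) \<le> 0" using False uv by (simp add: mult_le_0_iff)
      ultimately show False using uv by simp
    qed
    then show ?thesis by blast
  qed
  then show ?thesis by simp
qed

text \<open>These are the points of infinite upper derivative; the previous bound makes the measure
  of the n-th set at most a constant over n + 1.\<close>

lemma negligible_upper_fine_all:
  assumes F: "mono_on {a..b} F" and ab: "a \<le> b"
  shows "negligible (\<Inter>n. upper_fine F a b (real (Suc n)))" (is "negligible ?S")
proof -
  have m: "measure lebesgue (upper_fine F a b (real (Suc n))) \<le> (F b - F a) / real (Suc n)" for n
    using measure_upper_fine_le[OF F ab, of "real (Suc n)"] by (simp add: field_simps)
  show ?thesis unfolding negligible_outer
  proof (intro allI impI)
    fix e :: real assume "0 < e"
    have "((\<lambda>n. (F b - F a) / real (Suc n)) \<longlonglongrightarrow> 0)"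
      by (rule LIMSEQ_Suc) (rule lim_const_over_n)
    then have "\<forall>\<^sub>F n in sequentially. (F b - F a) / real (Suc n) < e"
      using \<open>0 < e\<close> by (rule order_tendstoD)
    then obtain n where "(F b - F a) / real (Suc n) < e" by (auto simp: eventually_sequentially)
    then show "\<exists>T. ?S \<subseteq> T \<and> T \<in> lmeasurable \<and> measure lebesgue T < e"
      using m[of n] by (intro exI[of _ "upper_fine F a b (real (Suc n))"]) (auto intro: fine_lmeasurable)
  qed
qed

text \<open>Lebesgue's theorem. The exceptional set \<open>?N\<close> collects the discontinuities,
  the points of infinite upper derivative, and, over all rational p < q, the points where quotients
  below \<open>p\<close> and above \<open>q\<close> both persist. Elsewhere the quotients over
  intervals around \<open>x\<close> converge, and continuity at \<open>x\<close> lets one endpoint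
  tend to \<open>x\<close>.\<close>

lemma mono_on_differentiable_ae:
  assumes F: "mono_on {a..b} (F :: real \<Rightarrow> real)"
  shows "negligible {x \<in> {a<..<b}. \<not> F differentiable (at x)}"
proof (cases "a \<le> b")
  case ab: True
  let ?N = "{x \<in> {a..b}. \<not> continuous (at x within {a..b}) F}
     \<union> (\<Inter>n. upper_fine F a b (real (Suc n)))
     \<union> (\<Union>(p, q)\<in>{(p, q). p \<in> \<rat> \<and> q \<in> \<rat> \<and> p < q}. upper_fine F a b q \<inter> lower_fine F a b p)"
  have negN: "negligible ?N"
  proof (intro negligible_Un negligible_upper_fine_all F ab negligible_countable_Union)
    show "negligible {x \<in> {a..b}. \<not> continuous (at x within {a..b}) F}"
      unfolding negligible_iff_null_sets
      by (intro null_sets_completionI countable_imp_null_set_lborel mono_on_ctble_discont F)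
    show "countable ((\<lambda>(p, q). upper_fine F a b q \<inter> lower_fine F a b p) ` {(p, q). p \<in> \<rat> \<and> q \<in> \<rat> \<and> p < q})"
      by (intro countable_image countable_subset[OF _ countable_SIGMA[OF countable_rat countable_rat]]) auto
  qed (use negligible_fine_Int[OF F] in auto)
  have diff: "F differentiable (at x)" if x: "x \<in> {a<..<b}" "x \<notin> ?N" for x
  proof -
    have "continuous (at x within {a..b}) F" using x by auto
    then have cont: "isCont F x" using x(1)
      by (metis at_within_Icc_at greaterThanLessThan_iff)
    \<comment> \<open>The infimum \<open>L\<close> of \<open>S\<close> is the limsup of the
      difference quotients over shrinking intervals with \<open>x\<close> in the interior; it is the
      candidate for the derivative.\<close>
    define S where "S = {q. \<exists>d>0. \<forall>u v. u < x \<longrightarrow> x < v \<longrightarrow> v - u < d \<longrightarrow> a \<le> u \<longrightarrow> v \<le> b \<longrightarrow> F v - F u \<le> q * (v - u)}"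
    have S_iff: "q \<in> S \<longleftrightarrow> x \<notin> upper_fine F a b q" for q
      unfolding S_def upper_fine_def by (auto simp: not_less) (meson not_less)+
    have "\<exists>n. real (Suc n) \<in> S" using x(2) by (auto simp: S_iff)
    then have ne: "S \<noteq> {}" by auto
    have nonneg: "0 \<le> q" if qS: "q \<in> S" for q
    proof -
      obtain d where d: "d > 0" "\<And>u v. u < x \<Longrightarrow> x < v \<Longrightarrow> v - u < d \<Longrightarrow> a \<le> u \<Longrightarrow> v \<le> b \<Longrightarrow> F v - F u \<le> q * (v - u)"
        using qS unfolding S_def by blast
      define u where "u = max a (x - d / 3)"
      define v where "v = min b (x + d / 3)"
      have uv: "u < x" "x < v" "v - u < d" "a \<le> u" "v \<le> b"
        using x(1) d(1) by (auto simp: u_def v_def)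
      have "F u \<le> F v" using uv by (intro monotone_onD[OF F]) auto
      then have "0 \<le> q * (v - u)" using d(2)[OF uv] by simp
      then show ?thesis using uv by (simp add: zero_le_mult_iff)
    qed
    then have bdd: "bdd_below S" by (intro bdd_belowI[of _ 0])
    define L where "L = Inf S"
    have main: "\<exists>d>0. \<forall>u v. u < x \<longrightarrow> x < v \<longrightarrow> v - u < d \<longrightarrow> a \<le> u \<longrightarrow> v \<le> b \<longrightarrow>
        \<bar>F v - F u - L * (v - u)\<bar> \<le> e * (v - u)" if e: "0 < e" for e
    proof -
      have "Inf S < L + e" using e by (simp add: L_def)
      then obtain q where q: "q \<in> S" "q < L + e"
        using cInf_lessD[OF ne] by blast
      then obtain d1 where d1: "d1 > 0" "\<And>u v. u < x \<Longrightarrow> x < v \<Longrightarrow> v - u < d1 \<Longrightarrow> a \<le> u \<Longrightarrow> v \<le> b \<Longrightarrow> F v - F u \<le> q * (v - u)"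
        unfolding S_def by blast
      \<comment> \<open>Two rationals just below \<open>L\<close> are needed: quotients above
        \<open>q1\<close> persist because \<open>q1\<close> lies below the infimum, and since
        \<open>x\<close> avoids the set of the pair (\<open>p1\<close>, \<open>q1\<close>),
        quotients below \<open>p1\<close> do not.\<close>
      obtain p1 where p1: "L - e < p1" "p1 < L" "p1 \<in> \<rat>"
        using Rats_dense_in_real[of "L - e" L] e by auto
      obtain q1 where q1: "p1 < q1" "q1 < L" "q1 \<in> \<rat>"
        using Rats_dense_in_real[of p1 L] p1 by auto
      have "q1 \<notin> S" using q1 cInf_lower[OF _ bdd, of q1] by (auto simp: L_def)
      then have "x \<in> upper_fine F a b q1" by (simp add: S_iff)
      then have "x \<notin> lower_fine F a b p1" using x(2) p1 q1 by blast
      then obtain d2 where d2: "d2 > 0" "\<And>u v. u < x \<Longrightarrow> x < v \<Longrightarrow> v - u < d2 \<Longrightarrow> a \<le> u \<Longrightarrow> v \<le> b \<Longrightarrow> F v - F u \<ge> p1 * (v - u)"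
        unfolding lower_fine_def by (auto simp: not_less) (meson not_less)
      show ?thesis
      proof (intro exI[of _ "min d1 d2"] conjI allI impI)
        show "0 < min d1 d2" using d1 d2 by simp
        fix u v assume uv: "u < x" "x < v" "v - u < min d1 d2" "a \<le> u" "v \<le> b"
        have "F v - F u \<le> q * (v - u)" "F v - F u \<ge> p1 * (v - u)" using d1(2)[of u v] d2(2)[of u v] uv by auto
        moreover have "q * (v - u) \<le> (L + e) * (v - u)" using q uv by (intro mult_right_mono) auto
        moreover have "(L - e) * (v - u) \<le> p1 * (v - u)" using p1 uv by (intro mult_right_mono) auto
        ultimately show "\<bar>F v - F u - L * (v - u)\<bar> \<le> e * (v - u)"
          by (simp add: abs_le_iff algebra_simps)
      qed
    qed
    have "(F has_derivative (\<lambda>h. L * h)) (at x)"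
      unfolding has_derivative_at_alt
    proof (intro conjI allI impI)
      show "bounded_linear (\<lambda>h. L * h)" by (rule bounded_linear_mult_right)
      fix e :: real assume e: "0 < e"
      obtain d where d: "d > 0" and dd: "\<And>u v. u < x \<Longrightarrow> x < v \<Longrightarrow> v - u < d \<Longrightarrow> a \<le> u \<Longrightarrow> v \<le> b \<Longrightarrow>
          \<bar>F v - F u - L * (v - u)\<bar> \<le> e * (v - u)" using main[OF e] by blast
      \<comment> \<open>Half of \<open>d\<close> is reserved for the other endpoint, which
        approaches \<open>x\<close> from the opposite side within \<open>d / 2\<close>.\<close>
      define d' where "d' = min (d / 2) (min (x - a) (b - x))"
      show "\<exists>d>0. \<forall>y. norm (y - x) < d \<longrightarrow> norm (F y - F x - L * (y - x)) \<le> e * norm (y - x)"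
      proof (intro exI[of _ d'] conjI allI impI)
        show "0 < d'" using d x(1) by (simp add: d'_def)
        fix y assume y: "norm (y - x) < d'"
        consider "y = x" | "x < y" | "y < x" by linarith
        then show "norm (F y - F x - L * (y - x)) \<le> e * norm (y - x)"
        proof cases
          case 2
          have "((\<lambda>u. \<bar>F y - F u - L * (y - u)\<bar>) \<longlongrightarrow> \<bar>F y - F x - L * (y - x)\<bar>) (at_left x)"
            using cont by (auto intro!: tendsto_intros simp: isCont_def filterlim_at_split)
          moreover have "((\<lambda>u. e * (y - u)) \<longlongrightarrow> e * (y - x)) (at_left x)"
            by (auto intro!: tendsto_intros)
          moreover have "\<forall>\<^sub>F u in at_left x. \<bar>F y - F u - L * (y - u)\<bar> \<le> e * (y - u)"
          proof -
            have "\<forall>\<^sub>F u in at_left x. u \<in> {max a (x - d / 2)<..<x}"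
              using x(1) d by (intro eventually_at_leftI[of "max a (x - d / 2)"]) auto
            then show ?thesis
              by eventually_elim (use 2 y in \<open>auto simp: d'_def intro!: dd\<close>)
          qed
          ultimately have "\<bar>F y - F x - L * (y - x)\<bar> \<le> e * (y - x)"
            by (intro tendsto_le[OF trivial_limit_at_left_real])
          then show ?thesis using 2 by simp
        next
          case 3
          have "((\<lambda>u. \<bar>F u - F y - L * (u - y)\<bar>) \<longlongrightarrow> \<bar>F x - F y - L * (x - y)\<bar>) (at_right x)"
            using cont by (auto intro!: tendsto_intros simp: isCont_def filterlim_at_split)
          moreover have "((\<lambda>u. e * (u - y)) \<longlongrightarrow> e * (x - y)) (at_right x)"
            by (auto intro!: tendsto_intros)
          moreover have "\<forall>\<^sub>F u in at_right x. \<bar>F u - F y - L * (u - y)\<bar> \<le> e * (u - y)"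
          proof -
            have "\<forall>\<^sub>F u in at_right x. u \<in> {x<..<min b (x + d / 2)}"
              using x(1) d by (intro eventually_at_rightI[of _ "min b (x + d / 2)"]) auto
            then show ?thesis
              by eventually_elim (use 3 y in \<open>auto simp: d'_def intro!: dd\<close>)
          qed
          ultimately have "\<bar>F x - F y - L * (x - y)\<bar> \<le> e * (x - y)"
            by (intro tendsto_le[OF trivial_limit_at_right_real])
          moreover have "\<bar>F x - F y - L * (x - y)\<bar> = \<bar>F y - F x - L * (y - x)\<bar>"
            by (simp add: abs_if algebra_simps)
          ultimately show ?thesis using 3 by simp
        qed simp
      qed
    qed
    then show ?thesis unfolding differentiable_def by blast
  qed
  show ?thesis
  proof (rule negligible_subset[OF negN])
    show "{x \<in> {a<..<b}. \<not> F differentiable (at x)} \<subseteq> ?N"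
    proof
      fix x assume "x \<in> {x \<in> {a<..<b}. \<not> F differentiable (at x)}"
      then show "x \<in> ?N" using diff[of x] by (intro ccontr[of "x \<in> ?N"]) simp
    qed
  qed
qed simp

section \<open>From monotone to absolutely continuous functions, and the fundamental theorem of
  calculus\<close>

lemma division_of_realD:
  fixes D :: "real set set"
  assumes "D division_of S" "I \<in> D"
  shows "I = {Inf I..Sup I}" "Inf I \<le> Sup I"
proof -
  obtain a b where I: "I = {a..b}" "I \<noteq> {}"
    using division_ofD(3,4)[OF assms] unfolding box_real by blast
  then show "I = {Inf I..Sup I}" "Inf I \<le> Sup I" by auto
qed

lemma sum_division_lengths:
  fixes D :: "real set set"
  assumes "D division_of S"
  shows "(\<Sum>I\<in>D. Sup I - Inf I) = measure lebesgue S"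
proof -
  have "(\<Sum>I\<in>D. Sup I - Inf I) = (\<Sum>I\<in>D. measure lebesgue I)"
  proof (rule sum.cong)
    fix I assume "I \<in> D"
    note I = division_of_realD[OF assms this]
    show "Sup I - Inf I = measure lebesgue I"
      using I(2) by (subst I(1)) simp
  qed simp
  then show ?thesis using content_division[OF assms] by simp
qed

lemma sum_division_lengths_le:
  fixes D :: "real set set"
  assumes "D division_of S" "S \<subseteq> U" "U \<in> lmeasurable"
  shows "(\<Sum>I\<in>D. Sup I - Inf I) \<le> measure lebesgue U"
  unfolding sum_division_lengths[OF assms(1)]
  using assms lmeasurable_division[OF assms(1)]
  by (intro measure_mono_fmeasurable) (auto dest: fmeasurableD)

lemma bounded_variation_differentiable_ae:
  fixes f :: "real \<Rightarrow> real"
  assumes var: "\<And>D. D division_of \<Union>D \<Longrightarrow> \<Union>D \<subseteq> {c..d} \<Longrightarrow> (\<Sum>I\<in>D. \<bar>f (Sup I) - f (Inf I)\<bar>) \<le> B"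
  shows "negligible {x \<in> {c<..<d}. \<not> f differentiable (at x)}"
proof -
  \<comment> \<open>Both the variation \<open>V\<close> and \<open>V - f\<close> are nondecreasing.\<close>
  define S where "S x = {(\<Sum>I\<in>D. \<bar>f (Sup I) - f (Inf I)\<bar>) | D. D division_of \<Union>D \<and> \<Union>D \<subseteq> {c..x}}" for x
  define V where "V x = Sup (S x)" for x
  have ne: "S x \<noteq> {}" for x
    unfolding S_def by (auto intro!: exI[of _ "{}"])
  have bdd: "bdd_above (S x)" if "x \<le> d" for x
  proof (rule bdd_aboveI)
    fix s assume "s \<in> S x"
    then obtain D where D: "s = (\<Sum>I\<in>D. \<bar>f (Sup I) - f (Inf I)\<bar>)" "D division_of \<Union>D" "\<Union>D \<subseteq> {c..x}"
      unfolding S_def by blast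
    have "{c..x} \<subseteq> {c..d}" using that by auto
    then show "s \<le> B" using var[OF D(2)] D(1,3) by blast
  qed
  \<comment> \<open>Adjoining \<open>{x..y}\<close> to a family competing for \<open>V x\<close>
    gives one competing for \<open>V y\<close>, with the increment as surplus.\<close>
  have step: "V x + \<bar>f y - f x\<bar> \<le> V y" if xy: "c \<le> x" "x < y" "y \<le> d" for x y
  proof -
    have "V x \<le> V y - \<bar>f y - f x\<bar>"
      unfolding V_def[of x]
    proof (rule cSup_least[OF ne])
      fix s assume "s \<in> S x"
      then obtain D where D: "s = (\<Sum>I\<in>D. \<bar>f (Sup I) - f (Inf I)\<bar>)" "D division_of \<Union>D" "\<Union>D \<subseteq> {c..x}"
        unfolding S_def by blast
      have fin: "finite D" using D(2) by (rule division_of_finite)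
      \<comment> \<open>Families are sets, so the new interval adds its increment only if it is not
        already a member.\<close>
      have notin: "{x..y} \<notin> D"
      proof
        assume "{x..y} \<in> D"
        then have "y \<in> {c..x}" using D(3) xy by (meson Union_upper atLeastAtMost_iff less_imp_le order_refl subsetD)
        then show False using xy by auto
      qed
      have "insert {x..y} D division_of ({x..y} \<union> \<Union>D)"
      proof (rule division_ofI)
        show "finite (insert {x..y} D)" using fin by simp
        show "\<Union>(insert {x..y} D) = {x..y} \<union> \<Union>D" by simp
        fix I assume I: "I \<in> insert {x..y} D"
        show "I \<subseteq> {x..y} \<union> \<Union>D" using I by auto
        show "I \<noteq> {}" using I D(2) xy by auto
        show "\<exists>a b. I = cbox a b" using I division_ofD(4)[OF D(2)] by (metis box_real(2) insertE)
        fix J assume J: "J \<in> insert {x..y} D" "I \<noteq> J"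
        have *: "interior {x..y} \<inter> interior K = {}" if "K \<in> D" for K
        proof -
          have "interior K \<subseteq> interior {c..x}" using that D(3) by (intro interior_mono) auto
          then show ?thesis by auto
        qed
        show "interior I \<inter> interior J = {}"
          using I J *[of I] *[of J] division_ofD(5)[OF D(2), of I J] by (metis Int_commute insertE)
      qed
      moreover have "{x..y} \<union> \<Union>D \<subseteq> {c..y}" using D(3) xy by auto
      ultimately have "(\<Sum>I\<in>insert {x..y} D. \<bar>f (Sup I) - f (Inf I)\<bar>) \<in> S y"
        unfolding S_def by (intro CollectI exI[of _ "insert {x..y} D"]) auto
      then have "(\<Sum>I\<in>insert {x..y} D. \<bar>f (Sup I) - f (Inf I)\<bar>) \<le> V y"
        unfolding V_def by (intro cSup_upper bdd xy)
      then show "s \<le> V y - \<bar>f y - f x\<bar>"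
        using notin fin xy by (simp add: D(1))
    qed
    then show ?thesis by simp
  qed
  have V1: "mono_on {c..d} V" "mono_on {c..d} (\<lambda>x. V x - f x)"
  proof -
    have *: "V x + \<bar>f y - f x\<bar> \<le> V y" if "x \<in> {c..d}" "y \<in> {c..d}" "x \<le> y" for x y
      using step[of x y] that by (cases "x = y") auto
    show "mono_on {c..d} V"
      by (rule monotone_onI) (drule (2) *, linarith)
    show "mono_on {c..d} (\<lambda>x. V x - f x)"
      by (rule monotone_onI) (drule (2) *, linarith)
  qed
  have "f differentiable (at x)" if "V differentiable (at x)" "(\<lambda>x. V x - f x) differentiable (at x)" for x
    using differentiable_diff[OF that] by simp
  then have "{x \<in> {c<..<d}. \<not> f differentiable (at x)} \<subseteq>
    {x \<in> {c<..<d}. \<not> V differentiable (at x)} \<union> {x \<in> {c<..<d}. \<not> (\<lambda>x. V x - f x) differentiable (at x)}"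
    by blast
  then show ?thesis
    by (rule negligible_subset[OF negligible_Un[OF V1[THEN mono_on_differentiable_ae]]])
qed

text \<open>On an interval shorter than the \<delta> belonging to \<epsilon> = 1 the variation is at
  most 1. Countably many such intervals with rational endpoints cover the open interval.\<close>

lemma absolutely_continuous_on_differentiable_ae:
  assumes "absolutely_continuous_on {a..b} f"
  shows "negligible {x \<in> {a<..<b}. \<not> f differentiable (at x)}"
proof -
  obtain \<delta> where \<delta>: "\<delta> > 0" "\<And>D. D division_of \<Union>D \<Longrightarrow> \<Union>D \<subseteq> {a..b} \<Longrightarrow> (\<Sum>I\<in>D. Sup I - Inf I) < \<delta> \<Longrightarrow>
        (\<Sum>I\<in>D. \<bar>f (Sup I) - f (Inf I)\<bar>) < 1"
    using assms unfolding absolutely_continuous_on_def by (meson zero_less_one)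
  define T where "T = {(p, q). p \<in> \<rat> \<and> q \<in> \<rat> \<and> a \<le> p \<and> q \<le> b \<and> p \<le> q \<and> q - p < \<delta>}"
  define Z where "Z = (\<lambda>(p, q). {x \<in> {p<..<q}. \<not> f differentiable (at x)})"
  have "countable T" unfolding T_def
    by (rule countable_subset[OF _ countable_SIGMA[OF countable_rat countable_rat]]) auto
  have "negligible (\<Union>(Z ` T))"
  proof (rule negligible_countable_Union)
    show "countable (Z ` T)" using \<open>countable T\<close> by simp
    fix X assume "X \<in> Z ` T"
    then obtain p q where X: "X = {x \<in> {p<..<q}. \<not> f differentiable (at x)}"
      and pq: "a \<le> p" "q \<le> b" "p \<le> q" "q - p < \<delta>"
      unfolding T_def Z_def by auto
    show "negligible X" unfolding X
    proof (rule bounded_variation_differentiable_ae)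
      fix D assume D: "D division_of \<Union>D" "\<Union>D \<subseteq> {p..q}"
      have "(\<Sum>I\<in>D. Sup I - Inf I) \<le> q - p"
        using sum_division_lengths_le[OF D] pq by simp
      then show "(\<Sum>I\<in>D. \<bar>f (Sup I) - f (Inf I)\<bar>) \<le> 1"
        using \<delta>(2)[OF D(1)] D(2) pq by force
    qed
  qed
  moreover have "{x \<in> {a<..<b}. \<not> f differentiable (at x)} \<subseteq> \<Union>(Z ` T)"
  proof
    fix x assume x: "x \<in> {x \<in> {a<..<b}. \<not> f differentiable (at x)}"
    obtain p where p: "p \<in> \<rat>" "max a (x - \<delta> / 2) < p" "p < x"
      using Rats_dense_in_real[of "max a (x - \<delta> / 2)" x] x \<delta>(1) by auto
    obtain q where q: "q \<in> \<rat>" "x < q" "q < min b (x + \<delta> / 2)"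
      using Rats_dense_in_real[of x "min b (x + \<delta> / 2)"] x \<delta>(1) by auto
    have "(p, q) \<in> T" using p q unfolding T_def by auto
    moreover have "x \<in> Z (p, q)" unfolding Z_def using x p q by auto
    ultimately show "x \<in> \<Union>(Z ` T)" by blast
  qed
  ultimately show ?thesis by (rule negligible_subset)
qed

text \<open>Straddle lemma: \<open>x\<close> lies between \<open>u\<close> and \<open>v\<close>, so
  the errors at the two ends add up to \<open>e\<close> times |v - x| + |u - x| = v - u.\<close>

lemma tagged_increment_bound:
  assumes D: "\<And>y. \<bar>y - x\<bar> < d \<Longrightarrow> \<bar>f y - f x - D * (y - x)\<bar> \<le> e * \<bar>y - x\<bar>"
    and k: "x \<in> {u..v}" "{u..v} \<subseteq> ball x d"
  shows "\<bar>(v - u) * D - (f v - f u)\<bar> \<le> e * (v - u :: real)"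
proof -
  have "u \<in> ball x d" "v \<in> ball x d" using k by (meson atLeastAtMost_iff order_refl order_trans subsetD)+
  then have "\<bar>f v - f x - D * (v - x)\<bar> \<le> e * \<bar>v - x\<bar>" "\<bar>f u - f x - D * (u - x)\<bar> \<le> e * \<bar>u - x\<bar>"
    by (auto intro!: D simp: dist_real_def)
  then have "\<bar>f v - f x - D * (v - x)\<bar> + \<bar>f u - f x - D * (u - x)\<bar> \<le> e * (v - u)"
    using k(1) by (simp add: algebra_simps)
  then show ?thesis by (simp add: abs_if algebra_simps split: if_splits)
qed

text \<open>
  The gauge sends the tags in the exceptional null set into an open set of small measure, where the
  increments of \<open>f\<close> are controlled by absolute continuity.
\<close>

lemma absolutely_continuous_on_has_integral:
  fixes f :: "real \<Rightarrow> real"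
  assumes ab: "a \<le> b" and AC: "absolutely_continuous_on {a..b} f" and N: "negligible N"
    and f': "\<And>x. x \<in> {a<..<b} - N \<Longrightarrow> (f has_real_derivative f' x) (at x)"
  shows "(f' has_integral (f b - f a)) {a..b}"
proof -
  define N' where "N' = N \<union> {a, b}"
  have N': "negligible N'" unfolding N'_def using N by auto
  \<comment> \<open>Tags in \<open>N'\<close> then contribute nothing to the Riemann sum, and only
    the increment of \<open>f\<close> over their interval has to be controlled. The endpoints belong
    to \<open>N'\<close> because the derivative is given only in the open interval.\<close>
  define g where "g x = (if x \<in> N' then 0 else f' x)" for x
  have "(g has_integral (f b - f a)) {a..b}"
    unfolding has_integral_real
  proof (intro allI impI)
    fix e :: real assume e: "e > 0"
    \<comment> \<open>The summand 1 keeps the denominator positive when a = b; the other half of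
      \<open>e\<close> is for the tags in \<open>N'\<close>.\<close>
    define e1 where "e1 = e / 2 / (b - a + 1)"
    have e1: "e1 > 0" using e ab by (simp add: e1_def)
    have "e / 2 > 0" using e by simp
    then obtain \<delta> where \<delta>: "\<delta> > 0" "\<And>D. D division_of \<Union>D \<Longrightarrow> \<Union>D \<subseteq> {a..b} \<Longrightarrow> (\<Sum>I\<in>D. Sup I - Inf I) < \<delta> \<Longrightarrow>
        (\<Sum>I\<in>D. \<bar>f (Sup I) - f (Inf I)\<bar>) < e / 2"
      using AC unfolding absolutely_continuous_on_def by meson
    obtain U where U: "open U" "N' \<subseteq> U" "U \<in> lmeasurable" "measure lebesgue U < \<delta>"
    proof -
      have "N' \<in> null_sets lebesgue" using N' by (simp add: negligible_iff_null_sets)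
      then obtain T where T: "open T" "N' \<subseteq> T" "T - N' \<in> lmeasurable" "emeasure lebesgue (T - N') < ennreal \<delta>"
        using sets_lebesgue_outer_open[of N' \<delta>] \<delta>(1) by (metis null_setsD2)
      have "N' \<in> lmeasurable" using N' by (rule negligible_imp_measurable)
      moreover have "T = N' \<union> (T - N')" using T by auto
      ultimately have "T \<in> lmeasurable" using fmeasurable.Un[OF _ T(3)] by metis
      moreover have "measure lebesgue (T - N') < \<delta>"
        using T(3,4) \<delta>(1) by (simp add: emeasure_eq_measure2 ennreal_less_iff)
      then have "measure lebesgue T < \<delta>"
        using measure_Diff_null_set[OF _ \<open>N' \<in> null_sets lebesgue\<close>, of T] calculation by (auto dest: fmeasurableD)
      ultimately show thesis using T that by blast
    qed
    have "\<exists>d>0. \<forall>y. \<bar>y - x\<bar> < d \<longrightarrow> \<bar>f y - f x - g x * (y - x)\<bar> \<le> e1 * \<bar>y - x\<bar>" if x: "x \<in> {a..b} - N'" for x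
    proof -
      have "(f has_real_derivative g x) (at x)"
        using f'[of x] x by (auto simp: N'_def g_def)
      then have "(f has_derivative (\<lambda>h. g x * h)) (at x)"
        by (simp add: has_field_derivative_def)
      then show ?thesis using e1 unfolding has_derivative_at_alt by simp
    qed
    then obtain d where d: "\<And>x. x \<in> {a..b} - N' \<Longrightarrow> d x > 0"
      "\<And>x y. x \<in> {a..b} - N' \<Longrightarrow> \<bar>y - x\<bar> < d x \<Longrightarrow> \<bar>f y - f x - g x * (y - x)\<bar> \<le> e1 * \<bar>y - x\<bar>"
      by metis
    define \<gamma> where "\<gamma> x = (if x \<in> N' then U else if x \<in> {a..b} then ball x (d x) else UNIV)" for x
    have "gauge \<gamma>" unfolding gauge_def \<gamma>_def using d(1) U by auto
    moreover have "norm ((\<Sum>(x, k)\<in>p. measure lborel k *\<^sub>R g x) - (f b - f a)) < e"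
      if p: "p tagged_division_of {a..b}" "\<gamma> fine p" for p
    proof -
      \<comment> \<open>Passing from tagged pairs to intervals requires the value 0 on every
        interval without interior. Singletons have it automatically, but \<open>Sup {}\<close> and
        \<open>Inf {}\<close> are unspecified.\<close>
      define inc where "inc k = (if k = {} then 0 else \<bar>f (Sup k) - f (Inf k)\<bar>)" for k
      define q where "q = {(x, k) \<in> p. x \<in> N'}"
      note pD = tagged_division_ofD[OF p(1)]
      have fin: "finite p" by (rule pD)
      have qp: "q \<subseteq> p" by (auto simp: q_def)
      have intv: "\<exists>u v. k = {u..v} \<and> u \<le> v \<and> x \<in> {u..v} \<and> x \<in> {a..b}" if "(x, k) \<in> p" for x k
        using pD(2,3,4)[OF that] by auto
      have b1: "norm (measure lborel k *\<^sub>R g x - (f (Sup k) - f (Inf k))) \<le> e1 * measure lborel k + (if x \<in> N' then inc k else 0)"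
        if xk: "(x, k) \<in> p" for x k
      proof -
        obtain u v where k: "k = {u..v}" "u \<le> v" "x \<in> {u..v}" "x \<in> {a..b}" using intv[OF xk] by blast
        show ?thesis
        proof (cases "x \<in> N'")
          case True
          moreover have "0 \<le> e1 * (v - u)" using k e1 by simp
          ultimately show ?thesis using k by (simp add: g_def inc_def)
        next
          case False
          have "{u..v} \<subseteq> ball x (d x)" using fineD[OF p(2) xk] False k by (auto simp: \<gamma>_def)
          then have "\<bar>(v - u) * g x - (f v - f u)\<bar> \<le> e1 * (v - u)"
            using d(2)[of x] False k by (intro tagged_increment_bound[where x = x and d = "d x"]) auto
          then show ?thesis using False k by simp
        qed
      qed
      have q': "q tagged_division_of \<Union>(snd ` q)"
        using tagged_partial_division_of_Union_self[of q "{a..b}"] tagged_partial_division_subset[OF _ qp, of "{a..b}"] p(1)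
        by (auto simp: tagged_division_of_def)
      have "(\<Sum>(x, k)\<in>p. if x \<in> N' then inc k else 0) = (\<Sum>(x, k)\<in>q. inc k)"
        unfolding q_def by (intro sum.mono_neutral_cong_right fin) (auto split: if_splits)
      also have "\<dots> = (\<Sum>k\<in>snd ` q. inc k)"
        by (rule sum.over_tagged_division_lemma[OF q']) (auto simp: inc_def)
      also have "\<dots> = (\<Sum>k\<in>snd ` q. \<bar>f (Sup k) - f (Inf k)\<bar>)"
      proof (rule sum.cong)
        fix k assume "k \<in> snd ` q"
        then have "k \<noteq> {}" using qp intv by fastforce
        then show "inc k = \<bar>f (Sup k) - f (Inf k)\<bar>" by (simp add: inc_def)
      qed simp
      also have "\<dots> < e / 2"
      proof (rule \<delta>(2))
        show div: "snd ` q division_of \<Union>(snd ` q)" by (rule division_of_tagged_division[OF q'])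
        show "\<Union>(snd ` q) \<subseteq> {a..b}" using qp pD(3) by fastforce
        have "\<Union>(snd ` q) \<subseteq> U"
          using fineD[OF p(2)] unfolding q_def \<gamma>_def by fastforce
        then show "(\<Sum>I\<in>snd ` q. Sup I - Inf I) < \<delta>"
          using sum_division_lengths_le[OF div _ U(3)] U(4) by simp
      qed
      finally have b2: "(\<Sum>(x, k)\<in>p. if x \<in> N' then inc k else 0) < e / 2" .
      have "(\<Sum>(x, k)\<in>p. measure lborel k *\<^sub>R g x) - (f b - f a)
          = (\<Sum>(x, k)\<in>p. measure lborel k *\<^sub>R g x - (f (Sup k) - f (Inf k)))"
        unfolding additive_tagged_division_1[OF ab p(1), symmetric] by (simp add: sum_subtractf case_prod_beta')
      also have "norm \<dots> \<le> (\<Sum>(x, k)\<in>p. e1 * measure lborel k + (if x \<in> N' then inc k else 0))"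
        using b1 by (intro sum_norm_le) auto
      also have "\<dots> = e1 * (\<Sum>(x, k)\<in>p. measure lborel k) + (\<Sum>(x, k)\<in>p. if x \<in> N' then inc k else 0)"
        by (simp add: sum.distrib sum_distrib_left case_prod_beta')
      also have "(\<Sum>(x, k)\<in>p. measure lborel k) = b - a"
        using additive_content_tagged_division[of p a b] p(1) ab by simp
      also have "e1 * (b - a) + (\<Sum>(x, k)\<in>p. if x \<in> N' then inc k else 0) < e1 * (b - a + 1) + e / 2"
        using b2 e1 by (intro add_less_le_mono add_le_less_mono) auto
      also have "e1 * (b - a + 1) = e / 2"
        unfolding e1_def using ab by (intro nonzero_eq_divide_eq[THEN iffD1, OF _ refl]) simp
      finally show ?thesis by simp
    qed
    ultimately show "\<exists>\<gamma>. gauge \<gamma> \<and> (\<forall>\<D>. \<D> tagged_division_of {a..b} \<and> \<gamma> fine \<D> \<longrightarrow>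
        norm ((\<Sum>(x, k)\<in>\<D>. measure lborel k *\<^sub>R g x) - (f b - f a)) < e)"
      by (intro exI[of _ \<gamma>]) simp
  qed
  note g_int = this
  show ?thesis
    by (rule has_integral_spike[OF N' _ g_int]) (simp add: g_def)
qed

lemma absolutely_continuous_on_has_integral_deriv:
  fixes f :: "real \<Rightarrow> real"
  assumes "a \<le> b" "absolutely_continuous_on {a..b} f"
  shows "(deriv f has_integral (f b - f a)) {a..b}"
  by (rule absolutely_continuous_on_has_integral[OF assms absolutely_continuous_on_differentiable_ae[OF assms(2)]])
    (auto simp: DERIV_deriv_iff_real_differentiable)

section \<open>Kernels as second moments of their second derivative\<close>

lemma lipschitz_imp_absolutely_continuous_on:
  assumes L: "\<And>s t. s \<in> S \<Longrightarrow> t \<in> S \<Longrightarrow> \<bar>f s - f t\<bar> \<le> B * \<bar>s - t\<bar>"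
  shows "absolutely_continuous_on S f"
  unfolding absolutely_continuous_on_def
proof (intro allI impI)
  fix e :: real assume e: "0 < e"
  show "\<exists>\<delta>>0. \<forall>D. D division_of \<Union> D \<longrightarrow> \<Union> D \<subseteq> S \<longrightarrow> (\<Sum>I\<in>D. Sup I - Inf I) < \<delta> \<longrightarrow>
    (\<Sum>I\<in>D. \<bar>f (Sup I) - f (Inf I)\<bar>) < e"
  proof (intro exI[of _ "e / (\<bar>B\<bar> + 1)"] conjI allI impI)
    show "0 < e / (\<bar>B\<bar> + 1)" using e by simp
    fix D assume D: "D division_of \<Union> D" "\<Union> D \<subseteq> S" "(\<Sum>I\<in>D. Sup I - Inf I) < e / (\<bar>B\<bar> + 1)"
    have "(\<Sum>I\<in>D. \<bar>f (Sup I) - f (Inf I)\<bar>) \<le> (\<Sum>I\<in>D. (\<bar>B\<bar> + 1) * (Sup I - Inf I))"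
    proof (rule sum_mono)
      fix I assume I: "I \<in> D"
      note r = division_of_realD[OF D(1) I]
      have "Sup I \<in> I" "Inf I \<in> I" using r(2) by (subst (2) r(1); simp)+
      then have "Sup I \<in> S" "Inf I \<in> S" using I D(2) by blast+
      then have "\<bar>f (Sup I) - f (Inf I)\<bar> \<le> B * (Sup I - Inf I)" using L r(2) by fastforce
      also have "\<dots> \<le> (\<bar>B\<bar> + 1) * (Sup I - Inf I)" using r(2) by (intro mult_right_mono) auto
      finally show "\<bar>f (Sup I) - f (Inf I)\<bar> \<le> (\<bar>B\<bar> + 1) * (Sup I - Inf I)" .
    qed
    also have "\<dots> = (\<bar>B\<bar> + 1) * (\<Sum>I\<in>D. Sup I - Inf I)" by (simp add: sum_distrib_left)
    also have "\<dots> < e" using D(3) by (simp add: pos_less_divide_eq mult.commute)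
    finally show "(\<Sum>I\<in>D. \<bar>f (Sup I) - f (Inf I)\<bar>) < e" .
  qed
qed

lemma set_integrable_inverse_square:
  fixes u c :: real
  assumes "0 < u"
  shows "set_integrable lborel {u..} (\<lambda>t. c / t ^ 2)"
proof -
  have "(\<lambda>t. 1 / t ^ 2) absolutely_integrable_on {u..}"
    using has_integral_inverse_power_to_inf[of 2 u] assms
    by (intro nonnegative_absolutely_integrable_1) (auto simp: integrable_on_def)
  then have "set_integrable lborel {u..} (\<lambda>t. 1 / t ^ 2)"
    unfolding set_integrable_def by (subst (asm) integrable_completion) auto
  from set_integrable_mult_right[OF this, of c] show ?thesis by simp
qed

lemma set_integrable_moment:
  fixes m :: "real \<Rightarrow> real"
  assumes [measurable]: "m \<in> borel_measurable borel" and m_le: "\<And>t. \<bar>m t\<bar> \<le> M" and u: "0 < u"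
  shows "set_integrable lborel {u..} (\<lambda>t. (t - u) * m t / t ^ 3)"
proof (rule set_integrable_bound[OF set_integrable_inverse_square[OF u, of M]])
  show "set_borel_measurable lborel {u..} (\<lambda>t. (t - u) * m t / t ^ 3)"
    unfolding set_borel_measurable_def by measurable
  show "AE t in lborel. t \<in> {u..} \<longrightarrow> norm ((t - u) * m t / t ^ 3) \<le> norm (M / t ^ 2)"
  proof (intro AE_I2 impI)
    fix t assume "t \<in> {u..}"
    then have t: "u \<le> t" "0 < t" using u by auto
    have "\<bar>t - u\<bar> * \<bar>m t\<bar> \<le> t * M" using t u m_le by (intro mult_mono) auto
    then have "\<bar>t - u\<bar> * \<bar>m t\<bar> / t ^ 3 \<le> t * M / t ^ 3" using t by (intro divide_right_mono) auto
    also have "t * M / t ^ 3 = M / t ^ 2" using t by (simp add: power2_eq_square power3_eq_cube)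
    finally show "norm ((t - u) * m t / t ^ 3) \<le> norm (M / t ^ 2)"
      using t m_le[of 0] by (simp add: abs_mult)
  qed
qed

text \<open>\<open>m\<close> is a Borel representative of t^3 K''(t) that is bounded everywhere.
  Agreement is required only off \<open>N\<close>, since \<open>deriv (deriv K)\<close> has
  unspecified values where K' is not differentiable. Everything here lives on the positive
  half-line; oddness enters at the very end.\<close>

locale kernel =
  fixes K :: "real \<Rightarrow> real" and m :: "real \<Rightarrow> real" and M :: real and N :: "real set"
  assumes diff: "\<And>x. 0 < x \<Longrightarrow> K differentiable (at x)"
    and AC: "\<And>a b. 0 < a \<Longrightarrow> absolutely_continuous_on {a..b} (deriv K)"
    and lim: "(K \<longlongrightarrow> 0) at_top" "(deriv K \<longlongrightarrow> 0) at_top"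
    and m_meas [measurable]: "m \<in> borel_measurable borel" and m_le: "\<And>t. \<bar>m t\<bar> \<le> M"
    and N: "negligible N" and m_eq: "\<And>t. 0 < t \<Longrightarrow> t \<notin> N \<Longrightarrow> m t = t ^ 3 * deriv (deriv K) t"
begin

lemma M_nonneg: "0 \<le> M" using m_le[of 0] by simp

lemma deriv_increment:
  assumes "0 < a" "a \<le> b"
  shows "((\<lambda>t. m t / t ^ 3) has_integral (deriv K b - deriv K a)) {a..b}"
proof (rule has_integral_spike[OF N])
  show "(deriv (deriv K) has_integral (deriv K b - deriv K a)) {a..b}"
    using assms by (intro absolutely_continuous_on_has_integral_deriv AC)
  show "m t / t ^ 3 = deriv (deriv K) t" if "t \<in> {a..b} - N" for t
    using that assms m_eq[of t] by simp
qed

lemma deriv_lipschitz: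
  assumes "0 < a" "s \<in> {a..b}" "t \<in> {a..b}"
  shows "\<bar>deriv K s - deriv K t\<bar> \<le> M / a ^ 3 * \<bar>s - t\<bar>"
proof -
  have *: "\<bar>deriv K t - deriv K s\<bar> \<le> M / a ^ 3 * (t - s)" if st: "a \<le> s" "s \<le> t" for s t
  proof -
    have "norm (deriv K t - deriv K s) \<le> M / a ^ 3 * measure lborel (cbox s t)"
    proof (rule has_integral_bound)
      show "0 \<le> M / a ^ 3" using M_nonneg assms by simp
      show "((\<lambda>t. m t / t ^ 3) has_integral (deriv K t - deriv K s)) (cbox s t)"
        using deriv_increment[of s t] st assms by simp
      fix x assume "x \<in> cbox s t"
      then have "a \<le> x" using st by simp
      then have "\<bar>m x\<bar> / x ^ 3 \<le> M / a ^ 3"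
        using assms(1) m_le M_nonneg by (intro frac_le power_mono) auto
      then show "norm (m x / x ^ 3) \<le> M / a ^ 3" using \<open>a \<le> x\<close> assms(1) by simp
    qed
    then show ?thesis using st by simp
  qed
  show ?thesis using *[of s t] *[of t s] assms by (cases "s \<le> t") (auto simp: abs_minus_commute)
qed

text \<open>That K' vanishes at infinity does not by itself remove the boundary term
  \<open>(b - u) * deriv K b\<close>. Integrating the bound M/t^3 for |K''| from \<open>b\<close> to
  infinity yields the quadratic decay that does.\<close>

lemma deriv_decay:
  assumes "0 < b"
  shows "\<bar>deriv K b\<bar> \<le> M / (2 * b ^ 2)"
proof (rule tendsto_upperbound)
  have "((\<lambda>c. \<bar>deriv K c - deriv K b\<bar>) \<longlongrightarrow> \<bar>0 - deriv K b\<bar>) at_top"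
    by (intro tendsto_intros lim)
  then show "((\<lambda>c. \<bar>deriv K c - deriv K b\<bar>) \<longlongrightarrow> \<bar>deriv K b\<bar>) at_top" by simp
  show "\<forall>\<^sub>F c in at_top. \<bar>deriv K c - deriv K b\<bar> \<le> M / (2 * b ^ 2)"
    using eventually_ge_at_top[of b]
  proof eventually_elim
    case (elim c)
    have hi: "((\<lambda>t. M / t ^ 3) has_integral (- M / (2 * c ^ 2) - (- M / (2 * b ^ 2)))) {b..c}"
    proof (rule fundamental_theorem_of_calculus[OF elim])
      fix x assume "x \<in> {b..c}"
      then have "x > 0" using assms by simp
      then have "((\<lambda>x. - M / (2 * x ^ 2)) has_real_derivative M / x ^ 3) (at x within {b..c})"
        by (auto intro!: derivative_eq_intros simp: field_simps power2_eq_square power3_eq_cube)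
      then show "((\<lambda>x. - M / (2 * x ^ 2)) has_vector_derivative M / x ^ 3) (at x within {b..c})"
        by (simp add: has_real_derivative_iff_has_vector_derivative)
    qed
    have i: "((\<lambda>t. m t / t ^ 3) has_integral (deriv K c - deriv K b)) {b..c}"
      using elim assms by (intro deriv_increment)
    have "norm (integral {b..c} (\<lambda>t. m t / t ^ 3)) \<le> integral {b..c} (\<lambda>t. M / t ^ 3)"
    proof (rule integral_norm_bound_integral)
      show "(\<lambda>t. m t / t ^ 3) integrable_on {b..c}" "(\<lambda>t. M / t ^ 3) integrable_on {b..c}"
        using hi i by blast+
      fix x assume "x \<in> {b..c}"
      then have "0 < x" using assms by simp
      then show "norm (m x / x ^ 3) \<le> M / x ^ 3" using m_le by (simp add: divide_right_mono)
    qed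
    then have "\<bar>deriv K c - deriv K b\<bar> \<le> - M / (2 * c ^ 2) - (- M / (2 * b ^ 2))"
      using hi i by (simp add: integral_unique)
    also have "\<dots> \<le> M / (2 * b ^ 2)" using M_nonneg by simp
    finally show ?case .
  qed
qed simp

lemma deriv_bound:
  assumes "0 < a" "a \<le> b"
  shows "\<bar>deriv K b\<bar> \<le> M / (2 * a ^ 2)"
proof -
  have "M / (2 * b ^ 2) \<le> M / (2 * a ^ 2)"
    using assms M_nonneg by (intro divide_left_mono mult_mono power_mono) auto
  then show ?thesis using deriv_decay[of b] assms by simp
qed

text \<open>Integration by parts through the antiderivative
  \<open>L t = (t - u) * deriv K t - K t\<close>, where the two K' terms of the derivative cancel.
  \<open>L\<close> is Lipschitz because K' is bounded and Lipschitz away from 0, so the fundamental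
  theorem applies to it.\<close>

lemma first_moment:
  assumes u: "0 < u" "u \<le> b"
  shows "((\<lambda>t. (t - u) * m t / t ^ 3) has_integral ((b - u) * deriv K b - K b + K u)) {u..b}"
proof -
  define L where "L t = (t - u) * deriv K t - K t" for t
  define Z where "Z = {x \<in> {u<..<b}. \<not> deriv K differentiable (at x)}"
  have KD: "(K has_real_derivative deriv K x) (at x)" if "x > 0" for x
    using diff[OF that] by (simp add: DERIV_deriv_iff_real_differentiable)
  have "absolutely_continuous_on {u..b} L"
  proof (rule lipschitz_imp_absolutely_continuous_on)
    fix s t assume st: "s \<in> {u..b}" "t \<in> {u..b}"
    define B1 B2 where "B1 = M / u ^ 3" and "B2 = M / (2 * u ^ 2)"
    have "\<bar>K s - K t\<bar> \<le> B2 * \<bar>s - t\<bar>"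
      using field_differentiable_bound[of "{u..b}" K "deriv K" B2 s t] st u
        has_field_derivative_at_within[OF KD] deriv_bound[OF u(1)]
      by (simp add: B2_def)
    moreover have "\<bar>(s - u) * (deriv K s - deriv K t)\<bar> \<le> (b - u) * (B1 * \<bar>s - t\<bar>)"
      unfolding abs_mult B1_def using deriv_lipschitz[of u s b t] st u by (intro mult_mono) auto
    moreover have "\<bar>(s - t) * deriv K t\<bar> \<le> \<bar>s - t\<bar> * B2"
      unfolding abs_mult B2_def using deriv_bound[of u t] st u by (intro mult_mono) auto
    moreover have "L s - L t = (s - u) * (deriv K s - deriv K t) + (s - t) * deriv K t - (K s - K t)"
      unfolding L_def by (simp add: algebra_simps)
    ultimately have "\<bar>L s - L t\<bar> \<le> (b - u) * (B1 * \<bar>s - t\<bar>) + \<bar>s - t\<bar> * B2 + B2 * \<bar>s - t\<bar>"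
      by linarith
    then show "\<bar>L s - L t\<bar> \<le> ((b - u) * B1 + 2 * B2) * \<bar>s - t\<bar>"
      by (simp add: algebra_simps)
  qed
  moreover have "negligible Z" unfolding Z_def
    by (intro absolutely_continuous_on_differentiable_ae AC u)
  moreover have "(L has_real_derivative (x - u) * deriv (deriv K) x) (at x)" if "x \<in> {u<..<b} - Z" for x
  proof -
    have "(deriv K has_real_derivative deriv (deriv K) x) (at x)"
      using that by (simp add: Z_def DERIV_deriv_iff_real_differentiable)
    moreover have "(K has_real_derivative deriv K x) (at x)" using that u by (intro KD) simp
    ultimately show ?thesis unfolding L_def
      by (auto intro!: derivative_eq_intros)
  qed
  ultimately have "((\<lambda>x. (x - u) * deriv (deriv K) x) has_integral L b - L u) {u..b}"
    using u by (intro absolutely_continuous_on_has_integral[of u b L Z])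
  then have "((\<lambda>t. (t - u) * m t / t ^ 3) has_integral L b - L u) {u..b}"
  proof (rule has_integral_spike[OF N, rotated])
    show "(t - u) * m t / t ^ 3 = (t - u) * deriv (deriv K) t" if "t \<in> {u..b} - N" for t
      using that u m_eq[of t] by simp
  qed
  then show ?thesis by (simp add: L_def)
qed

text \<open>Taylor's formula based at infinity: as \<open>b\<close> grows in
  \<open>first_moment\<close> the boundary terms vanish, and the integrand is O(1/t^2).\<close>

lemma kernel_eq:
  assumes u: "0 < u"
  shows "K u = (LINT t:{u..}|lborel. (t - u) * m t / t ^ 3)"
proof -
  let ?f = "\<lambda>t. (t - u) * m t / t ^ 3"
  have "((\<lambda>b. LINT t:{u..b}|lborel. ?f t) \<longlongrightarrow> (LINT t:{u..}|lborel. ?f t)) at_top"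
    by (rule tendsto_set_lebesgue_integral_at_top[OF _ set_integrable_moment[OF m_meas m_le u]]) auto
  moreover have "((\<lambda>b. LINT t:{u..b}|lborel. ?f t) \<longlongrightarrow> 0 - 0 + K u) at_top"
  proof (rule Lim_transform_eventually)
    have "((\<lambda>b. (b - u) * deriv K b) \<longlongrightarrow> 0) at_top"
    proof (rule Lim_null_comparison)
      show "\<forall>\<^sub>F b in at_top. norm ((b - u) * deriv K b) \<le> M / 2 * inverse b"
        using eventually_ge_at_top[of u]
      proof eventually_elim
        case (elim b)
        have "\<bar>(b - u) * deriv K b\<bar> \<le> b * (M / (2 * b ^ 2))"
          unfolding abs_mult using elim u deriv_decay[of b] by (intro mult_mono) auto
        also have "\<dots> = M / 2 * inverse b" using elim u by (simp add: power2_eq_square field_simps)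
        finally show ?case by simp
      qed
      have "((\<lambda>b. M / 2 * inverse b) \<longlongrightarrow> M / 2 * 0) at_top"
        by (intro tendsto_intros tendsto_inverse_0_at_top filterlim_ident)
      then show "((\<lambda>b. M / 2 * inverse b) \<longlongrightarrow> 0) at_top" by simp
    qed
    then show "((\<lambda>b. (b - u) * deriv K b - K b + K u) \<longlongrightarrow> 0 - 0 + K u) at_top"
      by (intro tendsto_intros lim)
    show "\<forall>\<^sub>F b in at_top. (b - u) * deriv K b - K b + K u = (LINT t:{u..b}|lborel. ?f t)"
      using eventually_ge_at_top[of u]
    proof eventually_elim
      case (elim b)
      have "set_integrable lborel {u..b} ?f"
        by (rule set_integrable_subset[OF set_integrable_moment[OF m_meas m_le u]]) auto
      from set_borel_integral_eq_integral(2)[OF this] show ?case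
        using first_moment[OF u elim] by (simp add: integral_unique)
    qed
  qed
  ultimately show ?thesis
    using tendsto_unique[OF trivial_limit_at_top_linorder] by fastforce
qed

end

text \<open>
  A finite \<open>Linf_norm\<close> only yields measurability of \<open>\<bar>t\<^sup>3 K''(t)\<bar>\<close>; that of \<open>K''\<close> itself comes from its
  integrability on compact intervals.
\<close>

lemma second_derivative_representative:
  fixes K :: "real \<Rightarrow> real"
  assumes AC: "\<And>a b. 0 < a \<Longrightarrow> absolutely_continuous_on {a..b} (deriv K)"
    and bd: "AE t in lebesgue. \<bar>t ^ 3 * deriv (deriv K) t\<bar> \<le> M" and M: "0 \<le> M"
  obtains m N where "m \<in> borel_measurable borel" "\<And>t. \<bar>m t\<bar> \<le> M" "negligible N"
    "\<And>t. 0 < t \<Longrightarrow> t \<notin> N \<Longrightarrow> m t = t ^ 3 * deriv (deriv K) t"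
proof -
  let ?D = "deriv (deriv K)"
  have "(\<lambda>t. ?D t * indicator {1 / real (Suc n)..real (Suc n)} t) \<in> borel_measurable lebesgue" for n
    by (rule has_integral_implies_lebesgue_measurable_real, rule absolutely_continuous_on_has_integral_deriv)
      (auto intro!: AC simp: field_simps)
  moreover have "(\<lambda>n. ?D t * indicator {1 / real (Suc n)..real (Suc n)} t) \<longlonglongrightarrow> ?D t * indicator {0<..} t" for t
  proof (cases "0 < t")
    case True
    have "(\<lambda>n. 1 / real (Suc n)) \<longlonglongrightarrow> 0" by (rule LIMSEQ_Suc) (rule lim_const_over_n)
    then have "\<forall>\<^sub>F n in sequentially. 1 / real (Suc n) < t" using True by (rule order_tendstoD)
    moreover have "\<forall>\<^sub>F n in sequentially. t \<le> real n"
      using filterlim_real_sequentially by (simp add: filterlim_at_top)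
    ultimately have "\<forall>\<^sub>F n in sequentially. ?D t * indicator {1 / real (Suc n)..real (Suc n)} t = ?D t * indicator {0<..} t"
      by eventually_elim (use True in \<open>simp add: indicator_def\<close>)
    then show ?thesis by (rule tendsto_eventually)
  next
    case False
    have "indicator {1 / real (Suc n)..real (Suc n)} t = (0 :: real)" for n
    proof -
      have "0 < 1 / real (Suc n)" by simp
      then have "\<not> 1 / real (Suc n) \<le> t" using False by linarith
      then show ?thesis by (simp del: of_nat_Suc)
    qed
    then show ?thesis using False by simp
  qed
  ultimately have "(\<lambda>t. ?D t * indicator {0<..} t) \<in> borel_measurable lebesgue"
    by (rule borel_measurable_LIMSEQ_real[rotated])
  then have "(\<lambda>t. t ^ 3 * (?D t * indicator {0<..} t)) \<in> borel_measurable lebesgue"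
    by (rule borel_measurable_times[rotated]) (intro measurable_completion, simp)
  then obtain m' where m': "m' \<in> borel_measurable lborel" "AE t in lborel. t ^ 3 * (?D t * indicator {0<..} t) = m' t"
    using completion_ex_borel_measurable_real by blast
  \<comment> \<open>Truncation turns the almost everywhere bound into one valid everywhere and
    changes nothing where the bound already holds.\<close>
  define m where "m t = max (- M) (min M (m' t))" for t
  have "AE t in lebesgue. \<bar>t ^ 3 * ?D t\<bar> \<le> M \<and> t ^ 3 * (?D t * indicator {0<..} t) = m' t"
    using bd AE_completion[OF m'(2)] by eventually_elim simp
  then obtain N where N: "\<And>t. t \<in> space lebesgue - N \<Longrightarrow>
      \<bar>t ^ 3 * ?D t\<bar> \<le> M \<and> t ^ 3 * (?D t * indicator {0<..} t) = m' t" "N \<in> null_sets lebesgue"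
    by (elim AE_E3) (rule that; blast)
  show thesis
  proof
    show "m \<in> borel_measurable borel" using m'(1) unfolding m_def by simp
    show "\<bar>m t\<bar> \<le> M" for t using M by (auto simp: m_def)
    show "negligible N" using N(2) by (simp add: negligible_iff_null_sets)
    show "m t = t ^ 3 * ?D t" if "0 < t" "t \<notin> N" for t
    proof -
      have "\<bar>t ^ 3 * ?D t\<bar> \<le> M" "t ^ 3 * ?D t = m' t" using that N(1)[of t] by auto
      then show ?thesis by (auto simp: m_def)
    qed
  qed
qed

section \<open>The coefficient function and the correlation of the two step functions\<close>

text \<open>The argument 4/3 t carries the dominant coefficient. Reading the equation at
  \<open>3/4 * t\<close> and solving for that term gives the fixed point equation
  \<open>\<gamma> t = b t + A \<gamma> t\<close>.\<close>

lemma coefficient_exists: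
  fixes m :: "real \<Rightarrow> real"
  assumes m_meas [measurable]: "m \<in> borel_measurable borel" and m_le: "\<And>t. \<bar>m t\<bar> \<le> M"
  obtains \<gamma> :: "real \<Rightarrow> real" where "\<gamma> \<in> borel_measurable borel" "\<And>t. \<bar>\<gamma> t\<bar> \<le> 4/3 * M"
    "\<And>t. 1/8 * \<gamma> (4 * t) + 9/2 * \<gamma> (2 * t) - 99/8 * \<gamma> (4/3 * t) + 7 * \<gamma> t = m t"
proof -
  \<comment> \<open>In the sup norm \<open>A\<close> contracts by 8/99 (1/8 + 9/2 + 7) = 31/33, and
    \<open>p k\<close> below is the k-th term of its Neumann series.\<close>
  define A where "A f t = 8/99 * (1/8 * f (3 * t) + 9/2 * f (3/2 * t) + 7 * f (3/4 * t))"
    for f :: "real \<Rightarrow> real" and t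
  define b where "b t = - 8/99 * m (3/4 * t)" for t
  define p where "p k = (A ^^ k) b" for k
  have p_Suc: "p (Suc k) t = A (p k) t" for k t by (simp add: p_def)
  have p_meas: "p k \<in> borel_measurable borel" for k
  proof (induction k)
    case 0
    show ?case unfolding p_def b_def by simp
  next
    case (Suc k)
    note [measurable] = Suc
    show ?case unfolding p_Suc[abs_def] A_def by measurable
  qed
  have p_le: "\<bar>p k t\<bar> \<le> (31/33) ^ k * (8/99 * M)" for k t
  proof (induction k arbitrary: t)
    case 0
    show ?case using m_le[of "3/4 * t"] by (simp add: p_def b_def abs_mult)
  next
    case (Suc k)
    define X where "X = (31/33) ^ k * (8/99 * M)"
    have "\<bar>p k (3 * t)\<bar> \<le> X" "\<bar>p k (3/2 * t)\<bar> \<le> X" "\<bar>p k (3/4 * t)\<bar> \<le> X"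
      unfolding X_def by (rule Suc)+
    moreover have "\<bar>8/99 * (1/8 * x + 9/2 * y + 7 * z)\<bar> \<le> 31/33 * X"
      if "\<bar>x\<bar> \<le> X" "\<bar>y\<bar> \<le> X" "\<bar>z\<bar> \<le> X" for x y z :: real
      using that by (simp add: abs_le_iff)
    ultimately have "\<bar>8/99 * (1/8 * p k (3 * t) + 9/2 * p k (3/2 * t) + 7 * p k (3/4 * t))\<bar> \<le> 31/33 * X"
      by blast
    then show ?case unfolding p_Suc A_def by (simp add: X_def)
  qed
  \<comment> \<open>The constant arises as (8/99) / (1 - 31/33) = 4/3.\<close>
  have geo: "(\<lambda>k. (31/33 :: real) ^ k * (8/99 * M)) sums (4/3 * M)"
    using sums_mult2[OF geometric_sums[of "31/33 :: real"], of "8/99 * M"] by simp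
  have nsm: "summable (\<lambda>k. norm (p k t))" for t
    by (rule summable_comparison_test'[OF sums_summable[OF geo], of 0]) (use p_le in auto)
  have sm: "summable (\<lambda>k. p k t)" for t
    using nsm by (rule summable_norm_cancel)
  define \<gamma> where "\<gamma> t = (\<Sum>k. p k t)" for t
  have eq: "\<gamma> t = b t + A \<gamma> t" for t
  proof -
    have "\<gamma> t = p 0 t + (\<Sum>k. p (Suc k) t)"
      unfolding \<gamma>_def by (simp add: suminf_split_head[OF sm])
    also have "(\<lambda>k. p (Suc k) t) sums A \<gamma> t"
      unfolding p_Suc A_def \<gamma>_def
      by (intro sums_mult sums_add summable_sums sm)
    then have "(\<Sum>k. p (Suc k) t) = A \<gamma> t" by (simp add: sums_iff)
    finally show ?thesis by (simp add: p_def)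
  qed
  show thesis
  proof
    show "\<gamma> \<in> borel_measurable borel"
      unfolding \<gamma>_def by (intro borel_measurable_suminf p_meas)
    show "\<bar>\<gamma> t\<bar> \<le> 4/3 * M" for t
    proof -
      have "\<bar>\<gamma> t\<bar> \<le> (\<Sum>k. norm (p k t))"
        unfolding \<gamma>_def using summable_norm[OF nsm, of t] by simp
      also have "\<dots> \<le> (\<Sum>k. (31/33) ^ k * (8/99 * M))"
        using p_le by (intro suminf_le nsm sums_summable[OF geo]) auto
      finally show ?thesis using geo by (simp add: sums_iff)
    qed
    show "1/8 * \<gamma> (4 * t) + 9/2 * \<gamma> (2 * t) - 99/8 * \<gamma> (4/3 * t) + 7 * \<gamma> t = m t" for t
      using eq[of "4/3 * t"] by (simp add: A_def b_def algebra_simps)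
  qed
qed

section \<open>The correlation function and its moments\<close>

lemma h_measurable [measurable]: "h \<in> borel_measurable borel"
  unfolding h_def by measurable

lemma g_measurable [measurable]: "g \<in> borel_measurable borel"
  unfolding g_def by measurable

lemma h_bound: "\<bar>h x\<bar> \<le> 7" and g_bound: "\<bar>g x\<bar> \<le> 1"
  by (auto simp: h_def g_def)

lemma h_eq_0: "x < 0 \<or> 1 \<le> x \<Longrightarrow> h x = 0" and g_eq_0: "x < 0 \<or> 1 \<le> x \<Longrightarrow> g x = 0"
  by (auto simp: h_def g_def)

text \<open>The length of the overlap of two intervals of length 1/4, as a function of their
  offset.\<close>

definition tent :: "real \<Rightarrow> real" where "tent x = max 0 (1/4 - \<bar>x\<bar>)"

lemma has_integral_tent:
  "has_bochner_integral lborel (\<lambda>w. indicator {p..<p + 1/4} w * indicator {q..<q + 1/4} w :: real) (tent (p - q))"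
proof -
  have "(\<lambda>w. indicator {p..<p + 1/4} w * indicator {q..<q + 1/4} w :: real) = indicator {max p q..<min p q + 1/4}"
    by (auto simp: indicator_def fun_eq_iff)
  moreover have "has_bochner_integral lborel (indicator {max p q..<min p q + 1/4} :: real \<Rightarrow> real)
      (measure lborel {max p q..<min p q + 1/4})"
    by (rule has_bochner_integral_real_indicator)
      (cases "max p q \<le> min p q + 1/4"; simp del: max.bounded_iff min_add_distrib_left)+
  moreover have "measure lborel {max p q..<min p q + 1/4} = tent (p - q)"
    by (cases "max p q \<le> min p q + 1/4") (auto simp: tent_def min_def max_def abs_if split: if_splits)
  ultimately show ?thesis by simp
qed

definition phi :: "real \<Rightarrow> real" where "phi u = (LINT w|lborel. h w * g (w - u))"

text \<open>\<open>h\<close> and \<open>g\<close> are combinations of indicators of the four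
  quarters, so bilinearity yields 16 tents with seven different offsets. Those at offset 0 cancel:
  -7 - 1 + 1 + 7 = 0.\<close>

lemma phi_eq_tent:
  "phi u = 5 * tent (u + 1/4) + 8 * tent (u + 1/2) - 7 * tent (u + 3/4)
    - 5 * tent (u - 1/4) - 8 * tent (u - 1/2) + 7 * tent (u - 3/4)"
proof -
  let ?H = "\<lambda>p w. indicator {p..<p + 1/4} w :: real"
  have h: "h w = 7 * ?H 0 w - ?H (1/4) w + ?H (1/2) w - 7 * ?H (3/4) w" for w
    by (auto simp: h_def indicator_def)
  have g: "g (w - u) = - ?H u w + ?H (u + 1/4) w + ?H (u + 1/2) w - ?H (u + 3/4) w" for w
    by (auto simp: g_def indicator_def)
  let ?I = "\<lambda>p q. LINT w|lborel. ?H p w * ?H q w"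
  have int: "integrable lborel (\<lambda>w. ?H p w * ?H q w)" for p q :: real
    using has_integral_tent by (rule integrable.intros)
  have I: "?I p q = tent (p - q)" for p q
    using has_integral_tent by (rule has_bochner_integral_integral_eq)
  have "phi u = (LINT w|lborel.
      7 * (- (?H 0 w * ?H u w) + ?H 0 w * ?H (u + 1/4) w + ?H 0 w * ?H (u + 1/2) w - ?H 0 w * ?H (u + 3/4) w)
      - (- (?H (1/4) w * ?H u w) + ?H (1/4) w * ?H (u + 1/4) w + ?H (1/4) w * ?H (u + 1/2) w - ?H (1/4) w * ?H (u + 3/4) w)
      + (- (?H (1/2) w * ?H u w) + ?H (1/2) w * ?H (u + 1/4) w + ?H (1/2) w * ?H (u + 1/2) w - ?H (1/2) w * ?H (u + 3/4) w)
      - 7 * (- (?H (3/4) w * ?H u w) + ?H (3/4) w * ?H (u + 1/4) w + ?H (3/4) w * ?H (u + 1/2) w - ?H (3/4) w * ?H (u + 3/4) w))"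
    unfolding phi_def h g by (intro Bochner_Integration.integral_cong) (simp_all only: algebra_simps)
  also have "\<dots> =
      7 * (- ?I 0 u + ?I 0 (u + 1/4) + ?I 0 (u + 1/2) - ?I 0 (u + 3/4))
      - (- ?I (1/4) u + ?I (1/4) (u + 1/4) + ?I (1/4) (u + 1/2) - ?I (1/4) (u + 3/4))
      + (- ?I (1/2) u + ?I (1/2) (u + 1/4) + ?I (1/2) (u + 1/2) - ?I (1/2) (u + 3/4))
      - 7 * (- ?I (3/4) u + ?I (3/4) (u + 1/4) + ?I (3/4) (u + 1/2) - ?I (3/4) (u + 3/4))"
    by (simp only: Bochner_Integration.integral_add Bochner_Integration.integral_diff
      Bochner_Integration.integral_minus integral_mult_right_zero int
      Bochner_Integration.integrable_add Bochner_Integration.integrable_diff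
      Bochner_Integration.integrable_minus integrable_mult_right)
  finally have *: "phi u = \<dots>" .
  have minus: "tent (p - (u + q)) = tent (u - (p - q))" for p q
    by (simp add: tent_def abs_minus_commute algebra_simps)
  have minus0: "tent (p - u) = tent (u - p)" for p
    by (simp add: tent_def abs_minus_commute)
  show ?thesis unfolding * I minus minus0 by simp
qed

lemma phi_minus: "phi (- u) = - phi u"
proof -
  have "tent (- u + c) = tent (u - c)" "tent (- u - c) = tent (u + c)" for c
    using abs_minus_cancel[of "u - c"] abs_minus_cancel[of "u + c"]
    by (simp_all add: tent_def del: abs_minus_cancel)
  then show ?thesis unfolding phi_eq_tent by simp
qed

text \<open>For u > 0 the correlation is continuous, piecewise linear and zero beyond 1, so it is
  determined by its slope jumps 2, 18, -22, 7 at the four kinks.\<close>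

lemma phi_pos:
  assumes "0 < u"
  shows "phi u = 2 * max 0 (1/4 - u) + 18 * max 0 (1/2 - u) - 22 * max 0 (3/4 - u) + 7 * max 0 (1 - u)"
proof -
  consider "u \<le> 1/4" | "1/4 \<le> u" "u \<le> 1/2" | "1/2 \<le> u" "u \<le> 3/4" | "3/4 \<le> u" "u \<le> 1" | "1 \<le> u"
    by linarith
  then show ?thesis using assms
    by cases (simp_all add: phi_eq_tent tent_def max_def abs_if field_simps)
qed

lemma phi_measurable [measurable]: "phi \<in> borel_measurable borel"
  unfolding phi_eq_tent[abs_def] tent_def by measurable

text \<open>The substitution t = c l: matching the integrands takes a factor c^3, and dt = c dl
  gives one power back, which leaves c^2.\<close>

lemma moment_rescale:
  fixes \<gamma> :: "real \<Rightarrow> real"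
  assumes [measurable]: "\<gamma> \<in> borel_measurable borel" and le: "\<And>t. \<bar>\<gamma> t\<bar> \<le> B"
    and u: "0 < u" and c: "0 < c"
  shows "has_bochner_integral lborel (\<lambda>l. indicator {0<..} l * (\<gamma> l * max 0 (c - u / l) / l ^ 2))
      (c ^ 2 * (LINT t:{u..}|lborel. (t - u) * \<gamma> (t / c) / t ^ 3))"
proof -
  define F where "F t = indicator {u..} t * ((t - u) * \<gamma> (t / c) / t ^ 3)" for t
  have F: "integrable lborel F"
    using set_integrable_moment[of "\<lambda>t. \<gamma> (t / c)" B u] le u unfolding F_def[abs_def] set_integrable_def by simp
  have "has_bochner_integral lborel (\<lambda>l. c ^ 3 * F (0 + c * l)) (c ^ 3 * (LINT l|lborel. F (0 + c * l)))"
    using F c by (intro has_bochner_integral_mult_right has_bochner_integral_integrable lborel_integrable_real_affine) auto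
  moreover have "(LINT t|lborel. F t) = c * (LINT l|lborel. F (0 + c * l))"
    using lborel_integral_real_affine[of c F 0] c by simp
  moreover have "c ^ 3 * F (0 + c * l) = indicator {0<..} l * (\<gamma> l * max 0 (c - u / l) / l ^ 2)" for l
  proof (cases "0 < l \<and> u \<le> c * l")
    case True
    then have "u / l \<le> c" by (simp add: pos_divide_le_eq)
    with True c show ?thesis
      by (simp add: F_def max_def field_simps power2_eq_square power3_eq_cube)
  next
    case False
    show ?thesis
    proof (cases "0 < l")
      case True
      then have "c \<le> u / l" using False by (simp add: pos_le_divide_eq)
      then show ?thesis using True False by (simp add: F_def max_def)
    next
      case l: False
      then have "c * l \<le> 0" using c by (simp add: mult_le_0_iff)
      then show ?thesis using l u by (simp add: F_def)
    qed
  qed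
  ultimately show ?thesis using c
    by (simp add: F_def[abs_def] set_lebesgue_integral_def power2_eq_square power3_eq_cube mult.assoc)
qed

lemma moment_combination:
  fixes \<gamma> m :: "real \<Rightarrow> real"
  assumes [measurable]: "\<gamma> \<in> borel_measurable borel" and le: "\<And>t. \<bar>\<gamma> t\<bar> \<le> B"
    and eq: "\<And>t. 1/8 * \<gamma> (4 * t) + 9/2 * \<gamma> (2 * t) - 99/8 * \<gamma> (4/3 * t) + 7 * \<gamma> t = m t"
    and u: "0 < u"
  shows "has_bochner_integral lborel (\<lambda>l. indicator {0<..} l * (\<gamma> l * phi (u / l) / l ^ 2))
      (LINT t:{u..}|lborel. (t - u) * m t / t ^ 3)"
proof -
  let ?M = "\<lambda>c. LINT t:{u..}|lborel. (t - u) * \<gamma> (t / c) / t ^ 3"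
  have int: "set_integrable lborel {u..} (\<lambda>t. (t - u) * \<gamma> (t / c) / t ^ 3)" for c
    using u le by (intro set_integrable_moment[of _ B]) auto
  let ?f = "\<lambda>c l. indicator {0<..} l * (\<gamma> l * max 0 (c - u / l) / l ^ 2)"
  have "has_bochner_integral lborel (\<lambda>l. 2 * ?f (1/4) l + 18 * ?f (1/2) l - 22 * ?f (3/4) l + 7 * ?f 1 l)
     (2 * ((1/4)^2 * ?M (1/4)) + 18 * ((1/2)^2 * ?M (1/2)) - 22 * ((3/4)^2 * ?M (3/4)) + 7 * (1^2 * ?M 1))"
    by (intro has_bochner_integral_add has_bochner_integral_diff has_bochner_integral_mult_right moment_rescale[OF assms(1) le u]) auto
  moreover have "2 * ?f (1/4) l + 18 * ?f (1/2) l - 22 * ?f (3/4) l + 7 * ?f 1 l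
      = indicator {0<..} l * (\<gamma> l * phi (u / l) / l ^ 2)" for l
    using u by (cases "0 < l") (auto simp: phi_pos algebra_simps add_divide_distrib diff_divide_distrib)
  \<comment> \<open>Each slope jump times the square of its kink is a coefficient of the equation
    for \<gamma>.\<close>
  moreover have "2 * ((1/4)^2 * ?M (1/4)) + 18 * ((1/2)^2 * ?M (1/2)) - 22 * ((3/4)^2 * ?M (3/4)) + 7 * (1^2 * ?M 1)
      = 1/8 * ?M (1/4) + 9/2 * ?M (1/2) - 99/8 * ?M (3/4) + 7 * ?M 1"
    by (simp add: power2_eq_square)
  moreover have "\<dots> = (LINT t:{u..}|lborel. 1/8 * ((t - u) * \<gamma> (t / (1/4)) / t ^ 3)
      + 9/2 * ((t - u) * \<gamma> (t / (1/2)) / t ^ 3) - 99/8 * ((t - u) * \<gamma> (t / (3/4)) / t ^ 3)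
      + 7 * ((t - u) * \<gamma> (t / 1) / t ^ 3))"
    by (simp only: set_integral_add set_integral_diff set_integral_mult_right int set_integrable_mult_right)
  moreover have "\<dots> = (LINT t:{u..}|lborel. (t - u) * m t / t ^ 3)"
    unfolding eq[symmetric]
    by (intro set_lebesgue_integral_cong) (auto simp: algebra_simps add_divide_distrib diff_divide_distrib)
  ultimately show ?thesis by simp
qed

section \<open>Random translations\<close>

text \<open>For bits this is the number with binary expansion 0.b1 b2 b3 ..., where bj is the digit
  \<beta> (n - j). The value 1 is possible, when all these digits are 1.\<close>

definition shift :: "int \<Rightarrow> (int \<Rightarrow> nat) \<Rightarrow> real" where
  "shift n \<beta> = (\<Sum>\<^sub>\<infinity>i\<in>{..<n}. 2 powi (i - n) * real (\<beta> i))"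

lemma prob_space_uniform_bit: "prob_space (uniform_count_measure {0, 1 :: nat})"
  by (rule prob_space_uniform_count_measure) auto

lemma prob_space_shift_measure: "prob_space shift_measure"
  unfolding shift_measure_def by (intro prob_space_PiM prob_space_uniform_bit)

interpretation shift_measure: prob_space shift_measure
  by (rule prob_space_shift_measure)

lemma space_shift_measure:
  assumes "\<beta> \<in> space shift_measure"
  shows "\<beta> i \<le> 1"
proof -
  have "\<beta> i \<in> {0, 1}"
    using assms by (auto simp: shift_measure_def space_PiM PiE_iff space_uniform_count_measure)
  then show ?thesis by auto
qed

lemma bit_measurable [measurable]: "(\<lambda>\<beta>. \<beta> i) \<in> measurable shift_measure (count_space UNIV)"
proof -
  have "(\<lambda>\<beta>. \<beta> i) \<in> measurable shift_measure (uniform_count_measure {0, 1})"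
    unfolding shift_measure_def by (rule measurable_component_singleton) simp
  then show ?thesis
    by (rule measurable_compose) (auto simp: measurable_def sets_uniform_count_measure space_uniform_count_measure)
qed

lemma bij_betw_below: "bij_betw (\<lambda>j. n - 1 - int j) UNIV {..<n}"
  by (rule bij_betwI[where g = "\<lambda>i. nat (n - 1 - i)"]) auto

lemma shift_term: "2 powi (n - 1 - int j - n) * x = (1/2) ^ Suc j * (x :: real)"
  by (simp add: power_int_def power_one_over field_simps nat_add_distrib)

lemma shift_summable_aux:
  assumes "\<And>i. \<beta> i \<le> (1 :: nat)"
  shows "summable (\<lambda>j. (1/2) ^ Suc j * real (\<beta> (n - 1 - int j)))"
proof (rule summable_comparison_test')
  show "summable (\<lambda>j. (1/2 :: real) ^ Suc j)" by (rule sums_summable[OF power_half_series])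
  show "norm ((1/2) ^ Suc j * real (\<beta> (n - 1 - int j))) \<le> (1/2) ^ Suc j" for j
    using assms[of "n - 1 - int j"] by (simp add: mult_left_le)
qed

lemma shift_summable:
  assumes "\<And>i. \<beta> i \<le> (1 :: nat)"
  shows "(\<lambda>i. 2 powi (i - n) * real (\<beta> i)) summable_on {..<n}"
proof -
  have "(\<lambda>j. (1/2) ^ Suc j * real (\<beta> (n - 1 - int j))) summable_on UNIV"
    using shift_summable_aux[OF assms] by (subst summable_on_UNIV_nonneg_real_iff) auto
  then show ?thesis
    unfolding summable_on_reindex_bij_betw[OF bij_betw_below, symmetric] shift_term .
qed

lemma shift_sums:
  assumes "\<And>i. \<beta> i \<le> (1 :: nat)"
  shows "(\<lambda>j. (1/2) ^ Suc j * real (\<beta> (n - 1 - int j))) sums shift n \<beta>"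
proof (rule has_sum_imp_sums)
  have "((\<lambda>i. 2 powi (i - n) * real (\<beta> i)) has_sum shift n \<beta>) {..<n}"
    unfolding shift_def by (rule has_sum_infsum[OF shift_summable[OF assms]])
  then show "((\<lambda>j. (1/2) ^ Suc j * real (\<beta> (n - 1 - int j))) has_sum shift n \<beta>) UNIV"
    unfolding has_sum_reindex_bij_betw[OF bij_betw_below, symmetric] shift_term .
qed

lemma shift_bounds:
  assumes "\<And>i. \<beta> i \<le> (1 :: nat)"
  shows "0 \<le> shift n \<beta>" "shift n \<beta> \<le> 1"
proof -
  show "0 \<le> shift n \<beta>" unfolding shift_def by (intro infsum_nonneg) auto
  show "shift n \<beta> \<le> 1"
  proof (rule sums_le[OF _ shift_sums[OF assms] power_half_series])
    show "(1/2) ^ Suc j * real (\<beta> (n - 1 - int j)) \<le> (1/2) ^ Suc j" for j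
      using assms[of "n - 1 - int j"] by (simp add: mult_left_le)
  qed
qed

lemma shift_measurable [measurable]: "shift n \<in> borel_measurable shift_measure"
proof (subst measurable_cong)
  fix \<beta> assume "\<beta> \<in> space shift_measure"
  then show "shift n \<beta> = (\<Sum>j. (1/2) ^ Suc j * real (\<beta> (n - 1 - int j)))"
    by (intro sums_unique shift_sums space_shift_measure)
qed measurable

text \<open>The digit at n - 1 is the leading one and does not enter \<open>shift (n - 1)\<close>;
  the remaining digits are those of \<open>shift (n - 1) \<beta>\<close> moved one place to the
  right.\<close>

lemma shift_upd:
  assumes "\<And>i. \<beta> i \<le> (1 :: nat)" and "x \<le> 1"
  shows "shift n (\<beta>(n - 1 := x)) = (real x + shift (n - 1) \<beta>) / 2"
proof -
  let ?\<beta> = "\<beta>(n - 1 := x)"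
  have bd: "?\<beta> i \<le> 1" for i using assms by simp
  have eq: "2 powi (i - n) * real (?\<beta> i) = 1/2 * (2 powi (i - (n - 1)) * real (\<beta> i))" if "i \<in> {..<n - 1}" for i
  proof -
    have "(2 :: real) powi (i - (n - 1)) = 2 powi ((i - n) + 1)" by (simp add: algebra_simps)
    also have "\<dots> = 2 powi (i - n) * 2" by (subst power_int_add) auto
    finally show ?thesis using that by simp
  qed
  have "{..<n} = insert (n - 1) {..<n - 1}" by auto
  then have "shift n ?\<beta> = 2 powi (n - 1 - n) * real (?\<beta> (n - 1)) + (\<Sum>\<^sub>\<infinity>i\<in>{..<n - 1}. 2 powi (i - n) * real (?\<beta> i))"
    unfolding shift_def
    by (simp only:) (rule infsum_insert[OF summable_on_subset_banach[OF shift_summable[of ?\<beta> n]]], use bd in auto)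
  also have "(\<Sum>\<^sub>\<infinity>i\<in>{..<n - 1}. 2 powi (i - n) * real (?\<beta> i)) = 1/2 * shift (n - 1) \<beta>"
    unfolding shift_def infsum_cmult_right'[symmetric] by (rule infsum_cong) (rule eq)
  also have "?\<beta> (n - 1) = x" by simp
  also have "(2 :: real) powi (n - 1 - n) = 1/2" by (simp add: power_int_minus)
  finally show ?thesis by (simp only: add_divide_distrib mult_1 times_divide_eq_left)
qed

text \<open>Replacing coordinate n - 1 by an independent fair bit preserves the product measure, and
  \<open>shift_upd\<close> evaluates the result for both bits. This self-similarity characterises
  the uniform law.\<close>

lemma shift_expectation_step:
  fixes \<psi> :: "real \<Rightarrow> real"
  assumes [measurable]: "\<psi> \<in> borel_measurable borel" and bd: "\<And>x. \<bar>\<psi> x\<bar> \<le> B"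
  shows "(LINT \<beta>|shift_measure. \<psi> (shift n \<beta>)) =
    ((LINT \<beta>|shift_measure. \<psi> (shift (n - 1) \<beta> / 2)) + (LINT \<beta>|shift_measure. \<psi> ((1 + shift (n - 1) \<beta>) / 2))) / 2"
proof -
  let ?U = "uniform_count_measure {0, 1 :: nat}"
  interpret U: prob_space ?U by (rule prob_space_uniform_bit)
  interpret UP: pair_prob_space ?U shift_measure ..
  let ?f = "\<lambda>(x, X). X(n - 1 := x) :: int \<Rightarrow> nat"
  have distr: "distr (?U \<Otimes>\<^sub>M shift_measure) shift_measure ?f = shift_measure"
    using distr_pair_PiM_eq_PiM[of UNIV "\<lambda>_. ?U" "n - 1"] prob_space_uniform_bit
    by (simp add: shift_measure_def)
  have [measurable]: "?f \<in> measurable (?U \<Otimes>\<^sub>M shift_measure) shift_measure"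
    unfolding shift_measure_def case_prod_beta'
    by (rule measurable_fun_upd[where J = UNIV]) auto
  have [measurable]: "real \<in> borel_measurable ?U"
    by (simp add: measurable_def sets_uniform_count_measure space_uniform_count_measure)
  have "(LINT \<beta>|shift_measure. \<psi> (shift n \<beta>)) = (LINT p|(?U \<Otimes>\<^sub>M shift_measure). \<psi> (shift n (?f p)))"
    by (subst distr[symmetric], rule integral_distr) measurable
  also have "\<dots> = (LINT p|(?U \<Otimes>\<^sub>M shift_measure). (\<lambda>(x, X). \<psi> ((real x + shift (n - 1) X) / 2)) p)"
  proof (rule Bochner_Integration.integral_cong)
    fix p assume "p \<in> space (?U \<Otimes>\<^sub>M shift_measure)"
    then have "fst p \<le> 1" "\<And>i. snd p i \<le> 1"
      using space_shift_measure by (auto simp: space_pair_measure space_uniform_count_measure)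
    then show "\<psi> (shift n (?f p)) = (\<lambda>(x, X). \<psi> ((real x + shift (n - 1) X) / 2)) p"
      by (simp add: case_prod_beta' shift_upd)
  qed simp
  also have "\<dots> = (LINT x|?U. LINT X|shift_measure. \<psi> ((real x + shift (n - 1) X) / 2))"
  proof (rule UP.integral_fst[symmetric])
    show "integrable (?U \<Otimes>\<^sub>M shift_measure) (\<lambda>(x, X). \<psi> ((real x + shift (n - 1) X) / 2))"
      by (rule UP.P.integrable_const_bound[of _ B]) (use bd in \<open>simp add: case_prod_beta'\<close>, measurable)
  qed
  also have "\<dots> = ((LINT \<beta>|shift_measure. \<psi> (shift (n - 1) \<beta> / 2)) + (LINT \<beta>|shift_measure. \<psi> ((1 + shift (n - 1) \<beta>) / 2))) / 2"
    by (subst integral_uniform_count_measure) auto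
  finally show ?thesis .
qed

lemma cdf_shift_step:
  "cdf (distr shift_measure borel (shift n)) t =
    (cdf (distr shift_measure borel (shift (n - 1))) (2 * t) + cdf (distr shift_measure borel (shift (n - 1))) (2 * t - 1)) / 2"
proof -
  have cdf: "cdf (distr shift_measure borel (shift n)) t = (LINT \<beta>|shift_measure. indicator {..t} (shift n \<beta>))" for n t
  proof -
    have "(LINT \<beta>|shift_measure. indicator {..t} (shift n \<beta>)) = (LINT x|distr shift_measure borel (shift n). indicator {..t} x :: real)"
      by (subst integral_distr) auto
    then show ?thesis by (simp add: cdf_def)
  qed
  have "indicator {..t} (x / 2) = (indicator {..2 * t} x :: real)"
    "indicator {..t} ((1 + x) / 2) = (indicator {..2 * t - 1} x :: real)" for x :: real
    by (auto simp: indicator_def)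
  then show ?thesis
    unfolding cdf using shift_expectation_step[of "indicator {..t}" 1 n] by simp
qed

text \<open>
  Outside \<open>[0, 1)\<close> the two distribution functions agree, so only one of the two terms of the recursion
  contributes to their difference, which is therefore halved at each step.
\<close>

lemma cdf_shift: "cdf (distr shift_measure borel (shift n)) t = max 0 (min 1 t)"
proof -
  let ?F = "\<lambda>n. cdf (distr shift_measure borel (shift n))"
  let ?c = "\<lambda>t. max 0 (min 1 t) :: real"
  have outside: "?F n t = ?c t" if "t < 0 \<or> 1 \<le> t" for n t
  proof -
    have F: "?F n t = measure shift_measure (shift n -` {..t} \<inter> space shift_measure)"
      unfolding cdf_def by (rule measure_distr) auto
    have bd: "0 \<le> shift n \<beta>" "shift n \<beta> \<le> 1" if "\<beta> \<in> space shift_measure" for \<beta>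
      by (intro shift_bounds space_shift_measure that)+
    from that show ?thesis
    proof
      assume t: "t < 0"
      then have "shift n -` {..t} \<inter> space shift_measure = {}" using bd by fastforce
      then show ?thesis using t F by simp
    next
      assume t: "1 \<le> t"
      then have "shift n -` {..t} \<inter> space shift_measure = space shift_measure" using bd by fastforce
      then show ?thesis using t F by (simp add: shift_measure.prob_space)
    qed
  qed
  have "\<bar>?F n t - ?c t\<bar> \<le> (1/2) ^ k" for k n t
  proof (induction k arbitrary: n t)
    case 0
    interpret D: real_distribution "distr shift_measure borel (shift n)" by simp
    have "0 \<le> ?F n t" "?F n t \<le> 1" using D.cdf_bounded_prob D.cdf_nonneg by auto
    moreover have "0 \<le> ?c t" "?c t \<le> 1" by auto
    ultimately show ?case unfolding power_0 abs_le_iff by linarith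
  next
    case (Suc k)
    \<comment> \<open>The uniform distribution function satisfies the same recursion.\<close>
    have "?c t = (?c (2 * t) + ?c (2 * t - 1)) / 2" by (auto simp: min_def max_def)
    then have "?F n t - ?c t = ((?F (n - 1) (2 * t) - ?c (2 * t)) + (?F (n - 1) (2 * t - 1) - ?c (2 * t - 1))) / 2"
      unfolding cdf_shift_step[of n t] by argo
    moreover have "?F (n - 1) (2 * t) - ?c (2 * t) = 0 \<or> ?F (n - 1) (2 * t - 1) - ?c (2 * t - 1) = 0"
      using outside[of "2 * t" "n - 1"] outside[of "2 * t - 1" "n - 1"] by (cases "t < 1/2") auto
    moreover have "\<bar>(x + y) / 2\<bar> \<le> 1/2 * z" if "\<bar>x\<bar> \<le> z" "\<bar>y\<bar> \<le> z" "x = 0 \<or> y = 0" for x y z :: real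
      using that by auto
    ultimately show ?case using Suc[of "n - 1" "2 * t"] Suc[of "n - 1" "2 * t - 1"]
      unfolding power_Suc by presburger
  qed
  moreover have "(\<lambda>k. (1/2 :: real) ^ k) \<longlonglongrightarrow> 0" by (rule LIMSEQ_power_zero) simp
  ultimately have "\<bar>?F n t - ?c t\<bar> \<le> 0"
    by (intro tendsto_lowerbound[of "\<lambda>k. (1/2 :: real) ^ k" 0 sequentially]) auto
  then show ?thesis by simp
qed

lemma distr_shift:
  "distr shift_measure borel (shift n) = density lborel (\<lambda>x. ennreal (indicator {0..<1} x))" (is "_ = ?W")
proof (rule cdf_unique)
  have em: "emeasure ?W A = emeasure lborel ({0..<1} \<inter> A)" if "A \<in> sets borel" for A
    using that by (subst emeasure_density) (auto simp: indicator_inter_arith[symmetric] ennreal_indicator nn_integral_indicator[symmetric] ennreal_mult' intro!: nn_integral_cong simp: indicator_def)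
  interpret W: prob_space ?W
    by standard (use em[of UNIV] in simp)
  show "real_distribution ?W" by standard simp
  show "real_distribution (distr shift_measure borel (shift n))" by simp
  show "cdf (distr shift_measure borel (shift n)) = cdf ?W"
  proof
    fix t :: real
    have "{0..<1} \<inter> {..t} = (if t < 0 then {} else if t < 1 then {0..t} else {0..<1})" by auto
    then have "cdf ?W t = max 0 (min 1 t)"
      unfolding cdf_def measure_def em[OF atMost_borel] by (simp add: min_def max_def)
    then show "cdf (distr shift_measure borel (shift n)) t = cdf ?W t" by (simp add: cdf_shift)
  qed
qed

lemma shift_expectation:
  fixes \<psi> :: "real \<Rightarrow> real"
  assumes [measurable]: "\<psi> \<in> borel_measurable borel"
  shows "(LINT \<beta>|shift_measure. \<psi> (shift n \<beta>)) = (LINT s|lborel. indicator {0..<1} s * \<psi> s)"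
proof -
  have "(LINT \<beta>|shift_measure. \<psi> (shift n \<beta>)) = (LINT s|distr shift_measure borel (shift n). \<psi> s)"
    by (subst integral_distr) auto
  also have "\<dots> = (LINT s|lborel. indicator {0..<1} s * \<psi> s)"
    unfolding distr_shift by (subst integral_density) auto
  finally show ?thesis .
qed

text \<open>As \<open>s\<close> runs through [0, 1), \<theta> - s and \<theta> + 1 - s sweep
  (\<theta> - 1, \<theta>] and (\<theta>, \<theta> + 1], which together contain the support [0, 1).
  Hence the result does not depend on the phase \<theta>.\<close>

lemma shift_expectation_periodized:
  fixes p :: "real \<Rightarrow> real"
  assumes p: "integrable lborel p" and supp: "\<And>w. w < 0 \<or> 1 \<le> w \<Longrightarrow> p w = 0"
    and \<theta>: "0 \<le> \<theta>" "\<theta> < 1"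
  shows "(LINT \<beta>|shift_measure. p (\<theta> - shift n \<beta>) + p (\<theta> + 1 - shift n \<beta>)) = (LINT w|lborel. p w)"
proof -
  have [measurable]: "p \<in> borel_measurable borel" using p by simp
  have aff: "(LINT s|lborel. indicator {0..<1} s * p (c - s)) = (LINT w|lborel. indicator {c - 1<..c} w * p w)"
    "integrable lborel (\<lambda>s. indicator {0..<1} s * p (c - s))" for c
  proof -
    have "integrable lborel (\<lambda>w. indicator {c - 1<..c} w * p w)"
      using p by (intro integrable_real_mult_indicator[unfolded mult.commute[of _ "indicator _ _"]]) auto
    note i = this
    have eq: "indicator {c - 1<..c} (c + - 1 * s) * p (c + - 1 * s) = indicator {0..<1} s * p (c - s)" for s
      by (auto simp: indicator_def)
    show "(LINT s|lborel. indicator {0..<1} s * p (c - s)) = (LINT w|lborel. indicator {c - 1<..c} w * p w)"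
      using lborel_integral_real_affine[of "- 1" "\<lambda>w. indicator {c - 1<..c} w * p w" c] unfolding eq by simp
    show "integrable lborel (\<lambda>s. indicator {0..<1} s * p (c - s))"
      using lborel_integrable_real_affine[OF i, of "- 1" c] unfolding eq by simp
  qed
  have "(LINT \<beta>|shift_measure. p (\<theta> - shift n \<beta>) + p (\<theta> + 1 - shift n \<beta>))
      = (LINT s|lborel. indicator {0..<1} s * p (\<theta> - s) + indicator {0..<1} s * p (\<theta> + 1 - s))"
    by (subst shift_expectation) (auto simp: distrib_left)
  also have "\<dots> = (LINT w|lborel. indicator {\<theta> - 1<..\<theta>} w * p w) + (LINT w|lborel. indicator {\<theta><..\<theta> + 1} w * p w)"
    using aff[of "\<theta> + 1"] by (simp add: aff)
  also have "\<dots> = (LINT w|lborel. indicator {\<theta> - 1<..\<theta>} w * p w + indicator {\<theta><..\<theta> + 1} w * p w)"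
    using p by (intro Bochner_Integration.integral_add[symmetric] integrable_real_mult_indicator[unfolded mult.commute[of _ "indicator _ _"]]) auto
  also have "\<dots> = (LINT w|lborel. p w)"
  proof (intro Bochner_Integration.integral_cong refl)
    fix w :: real
    show "indicator {\<theta> - 1<..\<theta>} w * p w + indicator {\<theta><..\<theta> + 1} w * p w = p w"
      using supp[of w] \<theta> by (cases "w < 0 \<or> 1 \<le> w") (auto simp: indicator_def)
  qed
  finally show ?thesis .
qed

section \<open>Sums over a dyadic grid and their averages\<close>

definition cell :: "real \<Rightarrow> (int \<Rightarrow> nat) \<Rightarrow> int \<Rightarrow> int \<Rightarrow> real set" where
  "cell r \<beta> n k = (\<lambda>t. r * 2 powi n * (t + of_int k + shift n \<beta>)) ` {0..<1}"

lemma dyadic_grid_eq: "dyadic_grid r \<beta> = (\<lambda>(n, k). cell r \<beta> n k) ` UNIV"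
  unfolding dyadic_grid_def cell_def shift_def by auto

lemma cell_eq:
  assumes "0 < r"
  shows "cell r \<beta> n k = {r * 2 powi n * (of_int k + shift n \<beta>)..<r * 2 powi n * (of_int k + shift n \<beta>) + r * 2 powi n}"
    (is "_ = {?a..<?a + ?l}")
proof -
  have l: "0 < ?l" using assms by simp
  have "cell r \<beta> n k = (\<lambda>t. ?l * t + ?a) ` {0..<1}"
    unfolding cell_def by (intro image_cong) (auto simp: algebra_simps)
  also have "\<dots> = {?a..<?a + ?l}"
  proof (intro equalityI subsetI)
    fix z assume "z \<in> {?a..<?a + ?l}"
    then have "(z - ?a) / ?l \<in> {0..<1}" using l by (simp add: pos_divide_less_eq)
    moreover have "z = ?l * ((z - ?a) / ?l) + ?a" using assms by simp
    ultimately show "z \<in> (\<lambda>t. ?l * t + ?a) ` {0..<1}" by blast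
  next
    fix z assume "z \<in> (\<lambda>t. ?l * t + ?a) ` {0..<1}"
    then obtain t where t: "0 \<le> t" "t < 1" "z = ?l * t + ?a" by auto
    moreover have "?l * t < ?l * 1" using l t by (intro mult_strict_left_mono) auto
    ultimately show "z \<in> {?a..<?a + ?l}" using l by simp
  qed
  finally show ?thesis .
qed

lemma measure_cell: "0 < r \<Longrightarrow> measure lborel (cell r \<beta> n k) = r * 2 powi n"
  by (simp add: cell_eq)

lemma Inf_cell: "0 < r \<Longrightarrow> Inf (cell r \<beta> n k) = r * 2 powi n * (of_int k + shift n \<beta>)"
  by (simp add: cell_eq)

text \<open>A grid is a set of intervals, so its sum is a sum over pairs (n, k) only if no interval
  arises twice. The length determines \<open>n\<close>, and then the left endpoint determines
  \<open>k\<close>.\<close>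

lemma inj_cell:
  assumes r: "0 < r"
  shows "inj (\<lambda>(n, k). cell r \<beta> n k)"
proof (rule injI, clarify)
  fix n k n' k' assume eq: "cell r \<beta> n k = cell r \<beta> n' k'"
  have "(2 :: real) powi n = 2 powi n'"
    using arg_cong[OF eq, of "measure lborel"] r by (simp add: measure_cell)
  then have n: "n = n'"
    using power_int_strict_increasing[of n n' "2 :: real"] power_int_strict_increasing[of n' n "2 :: real"]
    by (cases n n' rule: linorder_cases) auto
  have "real_of_int k = of_int k'"
    using arg_cong[OF eq, of Inf] r unfolding n by (simp add: Inf_cell)
  then show "n = n' \<and> k = k'" using n by simp
qed

text \<open>With w the relative position of \<open>x\<close> in the interval, that of
  \<open>y\<close> is w - (x - y)/l, which is the form of the integrand of \<open>phi\<close>. The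
  two square roots combine to 1/l.\<close>

lemma grid_term_cell:
  assumes "0 < r"
  defines "l n \<equiv> r * 2 powi n"
  shows "grid_term \<gamma> x y (cell r \<beta> n k) =
    \<gamma> (l n) / l n * (h (x / l n - of_int k - shift n \<beta>) * g (x / l n - of_int k - shift n \<beta> - (x - y) / l n))"
proof -
  have l: "0 < l n" using assms by simp
  have arg: "(z - l n * (of_int k + shift n \<beta>)) / l n = z / l n - of_int k - shift n \<beta>" for z
    using l by (simp add: field_simps)
  have "x / l n - of_int k - shift n \<beta> - (x - y) / l n = y / l n - of_int k - shift n \<beta>"
    by (simp add: diff_divide_distrib)
  moreover have "1 / sqrt (l n) * (1 / sqrt (l n)) = 1 / l n" using l by simp
  ultimately show ?thesis
    unfolding grid_term_def rescaled_def measure_cell[OF assms(1)] Inf_cell[OF assms(1)] l_def[symmetric] arg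
    by (simp add: field_simps)
qed

lemma summable_scale_bound:
  assumes d: "0 < (d :: real)"
  shows "(\<lambda>n :: int. if d < 2 powi (n + 1) then 1 / 2 powi n else 0 :: real) summable_on UNIV"
proof -
  obtain N :: nat where N: "1 / d < 2 ^ N" using real_arch_pow[of 2 "1 / d"] by auto
  \<comment> \<open>For n < m the exponent n + 1 is at most -N, and 2^(-N) is below
    \<open>d\<close>, so the cutoff removes these scales.\<close>
  define m where "m = - int N - 1"
  have low: "2 powi (n + 1) \<le> d" if "n < m" for n
  proof -
    have "(2 :: real) powi (n + 1) \<le> 2 powi (- int N)"
      using that by (intro power_int_increasing) (auto simp: m_def)
    also have "\<dots> = 1 / 2 ^ N" by (simp add: power_int_minus field_simps)
    also have "\<dots> \<le> d" using N d by (simp add: field_simps)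
    finally show ?thesis .
  qed
  have "bij_betw (\<lambda>j. m + int j) UNIV {m..}"
    by (rule bij_betwI[where g = "\<lambda>i. nat (i - m)"]) auto
  moreover have "(\<lambda>j. 1 / 2 powi (m + int j) :: real) summable_on UNIV"
  proof -
    have "summable (\<lambda>j. 1 / 2 powi m * (1 / 2) ^ j :: real)" by (intro summable_mult summable_geometric) simp
    also have "(\<lambda>j. 1 / 2 powi m * (1 / 2) ^ j :: real) = (\<lambda>j. 1 / 2 powi (m + int j))"
      by (simp add: power_int_add power_one_over field_simps)
    finally show ?thesis by (subst summable_on_UNIV_nonneg_real_iff) auto
  qed
  ultimately have "(\<lambda>n :: int. 1 / 2 powi n :: real) summable_on {m..}"
    by (rule summable_on_reindex_bij_betw[THEN iffD1])
  then have "(\<lambda>n :: int. if d < 2 powi (n + 1) then 1 / 2 powi n else 0 :: real) summable_on {m..}"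
    by (rule summable_on_comparison_test) auto
  then show ?thesis
  proof (subst summable_on_cong_neutral[of "{m..}" UNIV])
    show "(if d < 2 powi (n + 1) then 1 / 2 powi n else 0 :: real) = 0" if "n \<in> UNIV - {m..}" for n :: int
      using that low[of n] by (auto simp: not_le)
  qed auto
qed

text \<open>At each scale only two positions contribute, so the sum over the plane lives on the two
  disjoint graphs \<open>A 0\<close> and \<open>A 1\<close>, each of which is dominated by
  \<open>c\<close>.\<close>

lemma has_sum_two_diagonals:
  fixes f :: "int \<times> int \<Rightarrow> real" and fl :: "int \<Rightarrow> int"
  assumes zero: "\<And>n k. k \<noteq> fl n \<Longrightarrow> k \<noteq> fl n - 1 \<Longrightarrow> f (n, k) = 0"
    and le: "\<And>n k. \<bar>f (n, k)\<bar> \<le> c n" and c: "c summable_on UNIV"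
  shows "f summable_on UNIV" "((\<lambda>n. f (n, fl n) + f (n, fl n - 1)) has_sum infsum f UNIV) UNIV"
proof -
  define A where "A j = range (\<lambda>n. (n, fl n - j))" for j
  have sm: "(\<lambda>n. f (n, fl n - j)) summable_on UNIV" for j
    by (rule abs_summable_summable, rule summable_on_comparison_test[OF c]) (use le in auto)
  let ?s = "\<lambda>j. infsum (\<lambda>n. f (n, fl n - j)) UNIV"
  have hs: "(f has_sum ?s j) (A j)" for j
    unfolding A_def using has_sum_infsum[OF sm[of j]] by (subst has_sum_reindex) (auto simp: inj_on_def o_def)
  have "(f has_sum ?s 0 + ?s 1) (A 0 \<union> A 1)"
    by (rule has_sum_Un_disjoint[OF hs hs]) (auto simp: A_def)
  then have "(f has_sum ?s 0 + ?s 1) UNIV"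
  proof (subst has_sum_cong_neutral[of "A 0 \<union> A 1" UNIV])
    show "f p = 0" if p: "p \<in> UNIV - (A 0 \<union> A 1)" for p
    proof (cases p)
      case (Pair n k)
      have "k \<noteq> fl n" using p Pair by (auto simp: A_def)
      moreover have "k \<noteq> fl n - 1" using p Pair by (auto simp: A_def)
      ultimately show ?thesis using zero Pair by simp
    qed
  qed auto
  moreover have "((\<lambda>n. f (n, fl n - 0) + f (n, fl n - 1)) has_sum ?s 0 + ?s 1) UNIV"
    by (intro has_sum_add has_sum_infsum sm)
  ultimately show "f summable_on UNIV" "((\<lambda>n. f (n, fl n) + f (n, fl n - 1)) has_sum infsum f UNIV) UNIV"
    by (auto simp: summable_on_def infsumI)
qed

text \<open>The total contribution of the intervals of length l = r 2^n. With s =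
  \<open>shift n \<beta>\<close>, the position \<lfloor>x / l\<rfloor> gives the argument \<theta> -
  s and the one before it gives \<theta> + 1 - s.\<close>

definition layer :: "(real \<Rightarrow> real) \<Rightarrow> real \<Rightarrow> real \<Rightarrow> int \<Rightarrow> real \<Rightarrow> real \<Rightarrow> real" where
  "layer \<gamma> x y n r s = (let l = r * 2 powi n; p = (\<lambda>w. h w * g (w - (x - y) / l)); \<theta> = frac (x / l)
     in \<gamma> l / l * (p (\<theta> - s) + p (\<theta> + 1 - s)))"

lemma layer_measurable [measurable]:
  assumes [measurable]: "\<gamma> \<in> borel_measurable borel" "f \<in> borel_measurable N" "s \<in> borel_measurable N"
  shows "(\<lambda>z. layer \<gamma> x y n (f z) (s z)) \<in> borel_measurable N"
  unfolding layer_def Let_def frac_def by measurable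

text \<open>If both factors are nonzero, two points of [0, 1) differ by u/l, so |u| < l.\<close>

lemma haar_product_bound:
  assumes l: "0 < l" and G: "\<bar>\<gamma> l\<bar> \<le> B"
  shows "\<bar>\<gamma> l / l * (h w * g (w - u / l))\<bar> \<le> (if \<bar>u\<bar> < l then 7 * B / l else 0)"
proof (cases "\<bar>u\<bar> < l")
  case True
  have "\<bar>\<gamma> l / l * (h w * g (w - u / l))\<bar> = \<bar>\<gamma> l\<bar> / l * (\<bar>h w\<bar> * \<bar>g (w - u / l)\<bar>)"
    using l by (simp add: abs_mult)
  also have "\<dots> \<le> B / l * (7 * 1)"
    using l G h_bound g_bound by (intro mult_mono divide_right_mono) auto
  finally show ?thesis using True by (simp add: mult.commute)
next
  case False
  have "h w = 0 \<or> g (w - u / l) = 0"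
  proof (rule ccontr)
    assume "\<not> ?thesis"
    then have "0 \<le> w" "w < 1" "0 \<le> w - u / l" "w - u / l < 1"
      using h_eq_0[of w] g_eq_0[of "w - u / l"] by (force simp: not_le not_less)+
    then have "\<bar>u / l\<bar> < 1" by (auto simp: abs_less_iff)
    then have "\<bar>u\<bar> < l" using l by (simp add: abs_divide)
    then show False using False by simp
  qed
  then show ?thesis using False by auto
qed

text \<open>A majorant independent of the dilation: since l lies in [2^n, 2^(n+1)), the cutoff uses
  the upper end and the factor 1/l the lower end.\<close>

definition scale_bound :: "real \<Rightarrow> real \<Rightarrow> int \<Rightarrow> real" where
  "scale_bound B u n = 7 * B * (if \<bar>u\<bar> < 2 powi (n + 1) then 1 / 2 powi n else 0)"

lemma scale_bound_summable: "u \<noteq> 0 \<Longrightarrow> scale_bound B u summable_on UNIV"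
  unfolding scale_bound_def[abs_def] by (intro summable_on_cmult_right summable_scale_bound) simp

lemma haar_product_scale_bound:
  assumes r: "1 \<le> r" "r < 2" and G: "\<And>t. \<bar>\<gamma> t\<bar> \<le> B"
  defines "l n \<equiv> r * 2 powi n"
  shows "\<bar>\<gamma> (l n) / l n * (h w * g (w - u / l n))\<bar> \<le> scale_bound B u n"
proof -
  have l: "0 < l n" using r by (simp add: l_def)
  have B: "0 \<le> B" using G[of 0] by simp
  have "\<bar>\<gamma> (l n) / l n * (h w * g (w - u / l n))\<bar> \<le> (if \<bar>u\<bar> < l n then 7 * B / l n else 0)"
    by (rule haar_product_bound[OF l G])
  also have "\<dots> \<le> scale_bound B u n"
  proof (cases "\<bar>u\<bar> < l n")
    case True
    have "l n < 2 powi (n + 1)" using r by (simp add: l_def power_int_add)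
    moreover have "7 * B / l n \<le> 7 * B / 2 powi n"
      using B r by (intro divide_left_mono) (auto simp: l_def)
    ultimately show ?thesis using True by (simp add: scale_bound_def)
  next
    case False
    then show ?thesis using B by (simp add: scale_bound_def)
  qed
  finally show ?thesis .
qed

lemma layer_bound:
  assumes "1 \<le> r" "r < 2" "\<And>t. \<bar>\<gamma> t\<bar> \<le> B"
  shows "\<bar>layer \<gamma> x y n r s\<bar> \<le> 2 * scale_bound B (x - y) n"
proof -
  let ?l = "r * 2 powi n"
  let ?f = "\<lambda>w. \<gamma> ?l / ?l * (h w * g (w - (x - y) / ?l))"
  have "layer \<gamma> x y n r s = ?f (frac (x / ?l) - s) + ?f (frac (x / ?l) + 1 - s)"
    by (simp add: layer_def Let_def distrib_left)
  moreover have "\<bar>?f w\<bar> \<le> scale_bound B (x - y) n" for w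
    by (rule haar_product_scale_bound[OF assms])
  ultimately show ?thesis
    using abs_triangle_ineq[of "?f (frac (x / ?l) - s)" "?f (frac (x / ?l) + 1 - s)"]
    by (smt (verit, best))
qed

lemma grid_sum:
  assumes r: "1 \<le> r" "r < 2" and G: "\<And>t. \<bar>\<gamma> t\<bar> \<le> B" and xy: "x \<noteq> y" and \<beta>: "\<And>i. \<beta> i \<le> 1"
  shows "(\<lambda>I. \<bar>grid_term \<gamma> x y I\<bar>) summable_on dyadic_grid r \<beta>"
    "((\<lambda>n. layer \<gamma> x y n r (shift n \<beta>)) has_sum (\<Sum>\<^sub>\<infinity>I\<in>dyadic_grid r \<beta>. grid_term \<gamma> x y I)) UNIV"
proof -
  have r0: "0 < r" using r by simp
  let ?l = "\<lambda>n. r * 2 powi n"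
  let ?c = "\<lambda>(n, k). cell r \<beta> n k"
  define f where "f = grid_term \<gamma> x y \<circ> ?c"
  define fl where "fl n = \<lfloor>x / ?l n\<rfloor>" for n
  have f_eq: "f (n, k) = \<gamma> (?l n) / ?l n * (h (x / ?l n - of_int k - shift n \<beta>) * g (x / ?l n - of_int k - shift n \<beta> - (x - y) / ?l n))"
    for n k
    by (simp add: f_def grid_term_cell[OF r0])
  have le: "\<bar>f (n, k)\<bar> \<le> scale_bound B (x - y) n" for n k
    unfolding f_eq by (rule haar_product_scale_bound[OF r G])
  have zero: "f (n, k) = 0" if "k \<noteq> fl n" "k \<noteq> fl n - 1" for n k
  proof -
    have s: "0 \<le> shift n \<beta>" "shift n \<beta> \<le> 1" by (rule shift_bounds[OF \<beta>])+
    have "x / ?l n - of_int k - shift n \<beta> < 0 \<or> 1 \<le> x / ?l n - of_int k - shift n \<beta>"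
    proof (cases "fl n < k")
      case True
      then have "x / ?l n < of_int k" unfolding fl_def by (simp add: floor_less_iff)
      then show ?thesis using s by simp
    next
      case False
      \<comment> \<open>Two positions below the floor the argument of \<open>h\<close> is at least 2
        - 1 = 1, even if the shift equals 1; this is why exactly two positions have to be
        kept.\<close>
      then have "k + 2 \<le> fl n" using that by simp
      then have "of_int (k + 2) \<le> x / ?l n" unfolding fl_def by (simp only: le_floor_iff)
      then show ?thesis using s by simp
    qed
    then show ?thesis unfolding f_eq by (simp add: h_eq_0)
  qed
  have c: "scale_bound B (x - y) summable_on UNIV" using xy by (intro scale_bound_summable) simp
  have inj: "inj ?c" by (rule inj_cell[OF r0])
  have "(\<lambda>p. \<bar>f p\<bar>) summable_on UNIV"
    by (rule has_sum_two_diagonals(1)[OF _ _ c, of fl]) (use zero le in auto)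
  then show "(\<lambda>I. \<bar>grid_term \<gamma> x y I\<bar>) summable_on dyadic_grid r \<beta>"
    unfolding dyadic_grid_eq by (subst summable_on_reindex[OF inj]) (simp add: f_def o_def)
  have layer: "f (n, fl n) + f (n, fl n - 1) = layer \<gamma> x y n r (shift n \<beta>)" for n
  proof -
    have e: "x / ?l n - of_int (fl n) - shift n \<beta> = frac (x / ?l n) - shift n \<beta>"
      "x / ?l n - of_int (fl n - 1) - shift n \<beta> = frac (x / ?l n) + 1 - shift n \<beta>"
      by (simp_all add: frac_def fl_def)
    show ?thesis unfolding f_eq e layer_def Let_def by (rule distrib_left[symmetric])
  qed
  have "((\<lambda>n. f (n, fl n) + f (n, fl n - 1)) has_sum infsum f UNIV) UNIV"
    by (rule has_sum_two_diagonals(2)[OF zero le c])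
  then show "((\<lambda>n. layer \<gamma> x y n r (shift n \<beta>)) has_sum (\<Sum>\<^sub>\<infinity>I\<in>dyadic_grid r \<beta>. grid_term \<gamma> x y I)) UNIV"
    unfolding layer dyadic_grid_eq infsum_reindex[OF inj] f_def[symmetric] .
qed

lemma layer_expectation:
  assumes l: "0 < r"
  shows "(LINT \<beta>|shift_measure. layer \<gamma> x y n r (shift n \<beta>)) = \<gamma> (r * 2 powi n) / (r * 2 powi n) * phi ((x - y) / (r * 2 powi n))"
proof -
  let ?l = "r * 2 powi n"
  let ?p = "\<lambda>w. h w * g (w - (x - y) / ?l)"
  have "integrable lborel ?p"
  proof (rule Bochner_Integration.integrable_bound[of _ "\<lambda>w :: real. 7 * indicator {0..<1} w :: real"])
    show "integrable lborel (\<lambda>w :: real. 7 * indicator {0..<1} w :: real)"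
      by (intro integrable_mult_right integrable_real_indicator) auto
    show "AE w in lborel. norm (?p w) \<le> norm (7 * indicator {0..<1} w :: real)"
    proof (rule AE_I2)
      fix w show "norm (?p w) \<le> norm (7 * indicator {0..<1} w :: real)"
        using h_bound[of w] g_bound[of "w - (x - y) / ?l"] h_eq_0[of w]
          mult_mono[of "\<bar>h w\<bar>" 7 "\<bar>g (w - (x - y) / ?l)\<bar>" 1]
        by (cases "w < 0 \<or> 1 \<le> w") (auto simp: abs_mult indicator_def)
    qed
  qed measurable
  then have "(LINT \<beta>|shift_measure. ?p (frac (x / ?l) - shift n \<beta>) + ?p (frac (x / ?l) + 1 - shift n \<beta>)) = (LINT w|lborel. ?p w)"
    by (rule shift_expectation_periodized) (auto simp: h_eq_0 frac_ge_0 frac_lt_1)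
  then show ?thesis unfolding layer_def Let_def phi_def by simp
qed

section \<open>The dilation measure and the average over all grids\<close>

lemma space_dilation_measure: "space dilation_measure = {1..<2}"
  by (simp add: dilation_measure_def)

lemma borel_measurable_dilation_measure:
  assumes "f \<in> borel_measurable borel"
  shows "f \<in> borel_measurable dilation_measure"
proof -
  have "f \<in> borel_measurable (lebesgue_on {1..<2})"
    using assms by (intro measurable_restrict_space1 measurable_completion) simp
  then show ?thesis by (simp add: dilation_measure_def)
qed

lemma integral_dilation_measure:
  fixes F :: "real \<Rightarrow> real"
  assumes [measurable]: "F \<in> borel_measurable borel"
  shows "(LINT r|dilation_measure. F r) = (LINT r|lborel. indicator {1..<2} r * (F r / r))"
proof -
  have m: "f \<in> borel_measurable (lebesgue_on {1..<2})" if "f \<in> borel_measurable borel" for f :: "real \<Rightarrow> real"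
    using that by (intro measurable_restrict_space1 measurable_completion) simp
  have "(LINT r|dilation_measure. F r) = (LINT r|lebesgue_on {1..<2}. (1 / r) *\<^sub>R F r)"
    unfolding dilation_measure_def by (rule integral_density) (auto intro!: m AE_I2)
  also have "\<dots> = (LINT r|lebesgue. indicator {1..<2} r *\<^sub>R ((1 / r) *\<^sub>R F r))"
    by (rule integral_restrict_space) simp
  also have "\<dots> = (LINT r|lborel. indicator {1..<2} r *\<^sub>R ((1 / r) *\<^sub>R F r))"
    by (rule integral_completion) measurable
  finally show ?thesis by simp
qed

lemma ident_measurable_dilation_measure [measurable]: "(\<lambda>r. r) \<in> borel_measurable dilation_measure"
  by (rule borel_measurable_dilation_measure) simp

lemma finite_measure_dilation_measure: "finite_measure dilation_measure"
proof
  have [measurable]: "(\<lambda>r. ennreal (1 / r)) \<in> borel_measurable (lebesgue_on {1..<2})"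
    by (intro measurable_restrict_space1 measurable_completion) simp
  have "emeasure dilation_measure (space dilation_measure) = (\<integral>\<^sup>+r. ennreal (1 / r) \<partial>lebesgue_on {1..<2})"
    unfolding dilation_measure_def by (subst emeasure_density) (auto intro!: nn_integral_cong simp: indicator_def)
  also have "\<dots> \<le> (\<integral>\<^sup>+r. 1 \<partial>lebesgue_on {1..<2 :: real})"
    by (intro nn_integral_mono) (auto simp: ennreal_le_1)
  also have "\<dots> = emeasure lborel {1..<2 :: real}"
    by (simp add: emeasure_restrict_space)
  also have "\<dots> < \<infinity>" by simp
  finally show "emeasure dilation_measure (space dilation_measure) \<noteq> \<infinity>" by simp
qed

interpretation dilation_measure: finite_measure dilation_measure
  by (rule finite_measure_dilation_measure)

interpretation dilation_shift: pair_sigma_finite dilation_measure shift_measure ..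

lemma dilation_shift_finite: "finite_measure (dilation_measure \<Otimes>\<^sub>M shift_measure)"
  by (rule finite_measure_pair_measure) unfold_locales

lemma UN_dyadic_intervals:
  "(\<Union>n::int. {2 powi n..<2 powi (n + 1)}) = ({0<..} :: real set)" (is "?L = ?R")
proof (intro equalityI subsetI)
  fix l :: real assume "l \<in> ?L"
  then obtain n :: int where "2 powi n \<le> l" by auto
  moreover have "0 < (2 :: real) powi n" by simp
  ultimately show "l \<in> ?R" by (simp del: zero_less_power_int)
next
  fix l :: real assume "l \<in> ?R"
  then have l: "0 < l" by simp
  define n where "n = \<lfloor>log 2 l\<rfloor>"
  have pw: "2 powr real_of_int k = (2 :: real) powi k" for k
    by (simp add: powr_real_of_int')
  have "2 powr real_of_int n \<le> l" "l < 2 powr real_of_int (n + 1)"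
    using l unfolding n_def by (simp_all add: powr_le_iff less_powr_iff)
  then have "l \<in> {2 powi n..<2 powi (n + 1)}"
    unfolding pw by simp
  then show "l \<in> ?L" by blast
qed

lemma disjoint_dyadic_intervals:
  assumes "n \<noteq> m"
  shows "{2 powi n..<2 powi (n + 1)} \<inter> {2 powi m..<2 powi (m + 1)} = ({} :: real set)"
proof -
  have *: "{2 powi n..<2 powi (n + 1)} \<inter> {2 powi m..<2 powi (m + 1)} = ({} :: real set)" if "n < m" for n m :: int
  proof -
    have "(2 :: real) powi (n + 1) \<le> 2 powi m" using that by (intro power_int_increasing) auto
    then show ?thesis by auto
  qed
  show ?thesis using *[of n m] *[of m n] assms by (cases n m rule: linorder_cases) auto
qed

text \<open>The measure dr/r is scale invariant: l = r 2^n carries it to dl/l on one dyadic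
  interval, and over all \<open>n\<close> these intervals tile the positive half-line.\<close>

lemma integral_dilation_scaled:
  fixes G :: "real \<Rightarrow> real"
  assumes [measurable]: "G \<in> borel_measurable borel"
  shows "(LINT r|dilation_measure. G (r * 2 powi n)) = (LINT l:{2 powi n..<2 powi (n + 1)}|lborel. G l / l)"
proof -
  let ?c = "2 powi n :: real"
  have eq: "?c * (indicator {2 powi n..<2 powi (n + 1)} (0 + ?c * r) * (G (0 + ?c * r) / (0 + ?c * r)))
      = indicator {1..<2} r * (G (r * ?c) / r)" for r
    by (auto simp: indicator_def power_int_add mult.commute)
  have "(LINT l:{2 powi n..<2 powi (n + 1)}|lborel. G l / l)
    = ?c * (LINT r|lborel. indicator {2 powi n..<2 powi (n + 1)} (0 + ?c * r) * (G (0 + ?c * r) / (0 + ?c * r)))"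
    using lborel_integral_real_affine[of ?c "\<lambda>l. indicator {2 powi n..<2 powi (n + 1)} l * (G l / l)" 0]
    by (simp add: set_lebesgue_integral_def)
  also have "\<dots> = (LINT r|lborel. indicator {1..<2} r * (G (r * ?c) / r))"
    unfolding eq[symmetric] by (rule integral_mult_right_zero[symmetric])
  also have "\<dots> = (LINT r|dilation_measure. G (r * ?c))"
    by (rule integral_dilation_measure[symmetric]) measurable
  finally show ?thesis by simp
qed

text \<open>The sum is split by scale. The layers are dominated by summable constants on a finite
  measure space, so they may be integrated one by one; each yields the integral over its dyadic
  range of l, and countable additivity assembles these into \<open>J\<close>.\<close>

lemma grid_average:
  fixes \<gamma> :: "real \<Rightarrow> real"
  assumes [measurable]: "\<gamma> \<in> borel_measurable borel" and le: "\<And>t. \<bar>\<gamma> t\<bar> \<le> B" and xy: "x \<noteq> y"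
    and int: "has_bochner_integral lborel (\<lambda>l. indicator {0<..} l * (\<gamma> l * phi ((x - y) / l) / l ^ 2)) J"
  shows "AE (r, \<beta>) in dilation_measure \<Otimes>\<^sub>M shift_measure.
           (\<lambda>I. \<bar>grid_term \<gamma> x y I\<bar>) summable_on dyadic_grid r \<beta>" (is ?AE)
    and "integrable (dilation_measure \<Otimes>\<^sub>M shift_measure)
          (\<lambda>(r, \<beta>). \<Sum>\<^sub>\<infinity>I\<in>dyadic_grid r \<beta>. grid_term \<gamma> x y I)" (is ?Int)
    and "(LINT \<beta>|shift_measure. LINT r|dilation_measure. (\<Sum>\<^sub>\<infinity>I\<in>dyadic_grid r \<beta>. grid_term \<gamma> x y I)) = J" (is ?Eq)
proof -
  let ?M = "dilation_measure \<Otimes>\<^sub>M shift_measure"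
  let ?S = "\<lambda>(r, \<beta>). \<Sum>\<^sub>\<infinity>I\<in>dyadic_grid r \<beta>. grid_term \<gamma> x y I"
  interpret M: finite_measure ?M by (rule dilation_shift_finite)
  \<comment> \<open>Enumerating the scales by \<open>int_decode\<close> turns unordered sums over
    the integers into series, to which termwise integration applies.\<close>
  define T where "T i = (\<lambda>(r, \<beta>). layer \<gamma> x y (int_decode i) r (shift (int_decode i) \<beta>))" for i
  define c where "c i = 2 * scale_bound B (x - y) (int_decode i)" for i
  have sp: "1 \<le> r" "r < 2" "\<beta> i \<le> 1" if "(r, \<beta>) \<in> space ?M" for r \<beta> i
    using that space_shift_measure[of \<beta> i] by (auto simp: space_pair_measure space_dilation_measure)
  show ?AE
    by (rule AE_I2) (use grid_sum(1)[OF _ _ le xy] sp in auto)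
  have T_le: "norm (T i p) \<le> c i" if "p \<in> space ?M" for i p
    using layer_bound[OF _ _ le] sp that unfolding T_def c_def by (cases p) auto
  have Tm [measurable]: "T i \<in> borel_measurable ?M" for i
    unfolding T_def case_prod_beta' by measurable
  have "scale_bound B (x - y) \<circ> int_decode summable_on UNIV"
    using scale_bound_summable[of "x - y" B] xy bij_int_decode
    by (subst summable_on_reindex[symmetric]) (auto simp: bij_is_inj bij_is_surj)
  then have c: "summable c"
    unfolding c_def by (intro summable_mult) (auto dest: summable_on_imp_summable simp: o_def)
  have T_int: "integrable ?M (T i)" for i
    by (rule M.integrable_const_bound[of _ "c i"]) (use T_le in auto)
  have T_sm: "summable (\<lambda>i. norm (T i p))" if "p \<in> space ?M" for p
    by (rule summable_comparison_test'[OF c]) (use T_le[OF that] in auto)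
  have S_eq: "?S p = (\<Sum>i. T i p)" if p: "p \<in> space ?M" for p
  proof -
    obtain r \<beta> where [simp]: "p = (r, \<beta>)" by (cases p)
    have "((\<lambda>n. layer \<gamma> x y n r (shift n \<beta>)) has_sum (?S p)) UNIV"
      using grid_sum(2)[OF _ _ le xy] sp p by auto
    then have "((\<lambda>i. T i p) has_sum (?S p)) UNIV"
      unfolding has_sum_reindex_bij_betw[OF bij_int_decode, symmetric] by (simp add: T_def)
    then show ?thesis by (intro sums_unique has_sum_imp_sums)
  qed
  have AEs: "AE p in ?M. summable (\<lambda>i. norm (T i p))" using T_sm by (intro AE_I2)
  have sums: "summable (\<lambda>i. LINT p|?M. norm (T i p))"
  proof (rule summable_comparison_test')
    show "summable (\<lambda>i. c i * measure ?M (space ?M))" using c by (rule summable_mult2)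
    show "norm (LINT p|?M. norm (T i p)) \<le> c i * measure ?M (space ?M)" for i
    proof -
      have "(LINT p|?M. norm (T i p)) \<le> (LINT p|?M. c i)"
        using T_le T_int by (intro integral_mono) auto
      then show ?thesis by (simp add: mult.commute integral_nonneg_AE)
    qed
  qed
  have "integrable ?M (\<lambda>p. \<Sum>i. T i p)"
    by (rule integrable_suminf[OF T_int AEs sums])
  moreover have "integrable ?M ?S \<longleftrightarrow> integrable ?M (\<lambda>p. \<Sum>i. T i p)"
    by (rule Bochner_Integration.integrable_cong[OF refl S_eq])
  ultimately show S_int: ?Int by blast
  have T_val: "(LINT p|?M. T i p) = (LINT l:{2 powi int_decode i..<2 powi (int_decode i + 1)}|lborel. \<gamma> l * phi ((x - y) / l) / l ^ 2)" for i
  proof -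
    let ?n = "int_decode i"
    have "(LINT p|?M. T i p) = (LINT r|dilation_measure. LINT \<beta>|shift_measure. layer \<gamma> x y ?n r (shift ?n \<beta>))"
      using T_int[of i] unfolding T_def by (rule dilation_shift.integral_fst[symmetric])
    also have "\<dots> = (LINT r|dilation_measure. \<gamma> (r * 2 powi ?n) / (r * 2 powi ?n) * phi ((x - y) / (r * 2 powi ?n)))"
      by (intro Bochner_Integration.integral_cong refl layer_expectation) (simp add: space_dilation_measure)
    also have "\<dots> = (LINT l:{2 powi ?n..<2 powi (?n + 1)}|lborel. \<gamma> l / l * phi ((x - y) / l) / l)"
      by (rule integral_dilation_scaled) measurable
    \<comment> \<open>One factor 1/l comes from the normalisation of the rescaled functions, the
      other from dr/r.\<close>
    finally show ?thesis by (simp add: power2_eq_square)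
  qed
  have un: "(\<Union>i. {2 powi int_decode i..<2 powi (int_decode i + 1)}) = {0 :: real<..}"
    unfolding UN_dyadic_intervals[symmetric]
    using surj_def[of int_decode] bij_is_surj[OF bij_int_decode] by (auto; metis)
  have J: "J = (LINT l:{0<..}|lborel. \<gamma> l * phi ((x - y) / l) / l ^ 2)"
    using int by (simp add: set_lebesgue_integral_def has_bochner_integral_integral_eq)
  have "set_integrable lborel {0<..} (\<lambda>l. \<gamma> l * phi ((x - y) / l) / l ^ 2)"
    using int unfolding set_integrable_def by (auto intro: integrable.intros)
  then have J_sum: "J = (\<Sum>i. LINT l:{2 powi int_decode i..<2 powi (int_decode i + 1)}|lborel. \<gamma> l * phi ((x - y) / l) / l ^ 2)"
    unfolding J un[symmetric]
    by (intro lebesgue_integral_countable_add disjoint_dyadic_intervals)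
      (auto dest: injD[OF bij_is_inj[OF bij_int_decode]])
  \<comment> \<open>The translation is the outer integral here, while each layer was evaluated with
    the translation inside; the integral over the product mediates between the two orders.\<close>
  have "(LINT \<beta>|shift_measure. LINT r|dilation_measure. ?S (r, \<beta>)) = (LINT p|?M. ?S p)"
    using dilation_shift.integral_snd[OF S_int] by simp
  also have "\<dots> = (LINT p|?M. (\<Sum>i. T i p))"
    by (intro Bochner_Integration.integral_cong refl S_eq)
  also have "\<dots> = (\<Sum>i. LINT p|?M. T i p)"
    by (rule integral_suminf[OF T_int AEs sums])
  also have "\<dots> = J" unfolding T_val J_sum ..
  finally show ?Eq by simp
qed

section \<open>Essential suprema and the proof of the representation\<close>

lemma AE_abs_le_Linf_norm: "AE x in M. ereal \<bar>f x\<bar> \<le> Linf_norm M f"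
  unfolding Linf_norm_def by (rule esssup_AE)

text \<open>The essential supremum is an extended real, and over a null measure it would be
  -\<infinity>. Nonnegativity and finiteness together allow it to be named by a real number
  \<open>M\<close>.\<close>

lemma Linf_norm_lebesgue_nonneg: "0 \<le> Linf_norm lebesgue (f :: real \<Rightarrow> real)"
proof (rule ccontr)
  assume neg: "\<not> ?thesis"
  have "AE x in (lebesgue :: real measure). False"
  proof (rule eventually_mono[OF AE_abs_le_Linf_norm[of f lebesgue]])
    fix x assume "ereal \<bar>f x\<bar> \<le> Linf_norm lebesgue f"
    moreover have "0 \<le> ereal \<bar>f x\<bar>" by simp
    ultimately show False using neg by (meson order_trans)
  qed
  then show False by (simp add: eventually_False ae_filter_eq_bot_iff)
qed

theorem theorem2p4:
  shows "\<exists>C::real. \<forall>K :: real \<Rightarrow> real.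
    (\<forall>x. x \<noteq> 0 \<longrightarrow> K (- x) = - K x) \<longrightarrow>
    (\<forall>x. x \<noteq> 0 \<longrightarrow> K differentiable (at x)) \<longrightarrow>
    locally_absolutely_continuous_on (- {0}) (deriv K) \<longrightarrow>
    (K \<longlongrightarrow> 0) at_top \<longrightarrow>
    (deriv K \<longlongrightarrow> 0) at_top \<longrightarrow>
    Linf_norm lebesgue (\<lambda>x. x ^ 3 * deriv (deriv K) x) < \<infinity> \<longrightarrow>
    (\<exists>\<gamma> :: real \<Rightarrow> real.
      \<gamma> \<in> borel_measurable (lebesgue_on {0<..}) \<and>
      Linf_norm (lebesgue_on {0<..}) \<gamma>
        \<le> ereal C * Linf_norm lebesgue (\<lambda>x. x ^ 3 * deriv (deriv K) x) \<and>
      (\<forall>x y. x \<noteq> y \<longrightarrow>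
        (AE (r, \<beta>) in dilation_measure \<Otimes>\<^sub>M shift_measure.
           (\<lambda>I. \<bar>grid_term \<gamma> x y I\<bar>) summable_on dyadic_grid r \<beta>) \<and>
        integrable (dilation_measure \<Otimes>\<^sub>M shift_measure)
          (\<lambda>(r, \<beta>). \<Sum>\<^sub>\<infinity>I\<in>dyadic_grid r \<beta>. grid_term \<gamma> x y I) \<and>
        K (x - y) =
          (LINT \<beta>|shift_measure. LINT r|dilation_measure.
             (\<Sum>\<^sub>\<infinity>I\<in>dyadic_grid r \<beta>. grid_term \<gamma> x y I))))"
proof (intro exI[of _ "4/3"] allI impI)
  fix K :: "real \<Rightarrow> real"
  assume odd: "\<forall>x. x \<noteq> 0 \<longrightarrow> K (- x) = - K x"
    and diff: "\<forall>x. x \<noteq> 0 \<longrightarrow> K differentiable (at x)"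
    and lac: "locally_absolutely_continuous_on (- {0}) (deriv K)"
    and lim: "(K \<longlongrightarrow> 0) at_top" "(deriv K \<longlongrightarrow> 0) at_top"
    and fin: "Linf_norm lebesgue (\<lambda>x. x ^ 3 * deriv (deriv K) x) < \<infinity>"
  let ?L = "Linf_norm lebesgue (\<lambda>x. x ^ 3 * deriv (deriv K) x)"
  obtain M where M: "?L = ereal M" "0 \<le> M"
    using fin Linf_norm_lebesgue_nonneg[of "\<lambda>x. x ^ 3 * deriv (deriv K) x"] by (cases ?L) auto
  have AC: "absolutely_continuous_on {a..b} (deriv K)" if "0 < a" for a b
    using lac that unfolding locally_absolutely_continuous_on_def by auto
  have "AE t in lebesgue. \<bar>t ^ 3 * deriv (deriv K) t\<bar> \<le> M"
    using AE_abs_le_Linf_norm[of "\<lambda>x. x ^ 3 * deriv (deriv K) x" lebesgue] by (simp add: M)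
  then obtain m N where m: "m \<in> borel_measurable borel" "\<And>t. \<bar>m t\<bar> \<le> M" "negligible N"
    "\<And>t. 0 < t \<Longrightarrow> t \<notin> N \<Longrightarrow> m t = t ^ 3 * deriv (deriv K) t"
    using second_derivative_representative[of K M] AC M(2) by blast
  interpret kernel K m M N
    using diff AC lim m by unfold_locales auto
  obtain \<gamma> where \<gamma>: "\<gamma> \<in> borel_measurable borel" "\<And>t. \<bar>\<gamma> t\<bar> \<le> 4/3 * M"
    "\<And>t. 1/8 * \<gamma> (4 * t) + 9/2 * \<gamma> (2 * t) - 99/8 * \<gamma> (4/3 * t) + 7 * \<gamma> t = m t"
    using coefficient_exists[OF m(1,2)] by metis
  have pos: "has_bochner_integral lborel (\<lambda>l. indicator {0<..} l * (\<gamma> l * phi (u / l) / l ^ 2)) (K u)" if "0 < u" for u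
    using moment_combination[OF \<gamma> that] kernel_eq[OF that] by simp
  \<comment> \<open>For u < 0 the formula at \<open>- u\<close> is negated, as \<open>K\<close> and
    \<open>phi\<close> are both odd.\<close>
  have rep: "has_bochner_integral lborel (\<lambda>l. indicator {0<..} l * (\<gamma> l * phi (u / l) / l ^ 2)) (K u)" if "u \<noteq> 0" for u
  proof (cases "0 < u")
    case False
    then have "0 < - u" using that by simp
    then show ?thesis
      using has_bochner_integral_minus[OF pos[of "- u"]] odd that by (simp add: phi_minus)
  qed (rule pos)
  show "\<exists>\<gamma>. \<gamma> \<in> borel_measurable (lebesgue_on {0<..}) \<and>
      Linf_norm (lebesgue_on {0<..}) \<gamma> \<le> ereal (4/3) * ?L \<and>
      (\<forall>x y. x \<noteq> y \<longrightarrow>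
        (AE (r, \<beta>) in dilation_measure \<Otimes>\<^sub>M shift_measure.
           (\<lambda>I. \<bar>grid_term \<gamma> x y I\<bar>) summable_on dyadic_grid r \<beta>) \<and>
        integrable (dilation_measure \<Otimes>\<^sub>M shift_measure)
          (\<lambda>(r, \<beta>). \<Sum>\<^sub>\<infinity>I\<in>dyadic_grid r \<beta>. grid_term \<gamma> x y I) \<and>
        K (x - y) =
          (LINT \<beta>|shift_measure. LINT r|dilation_measure.
             (\<Sum>\<^sub>\<infinity>I\<in>dyadic_grid r \<beta>. grid_term \<gamma> x y I)))"
  proof (intro exI[of _ \<gamma>] conjI allI impI)
    show meas: "\<gamma> \<in> borel_measurable (lebesgue_on {0<..})"
      using \<gamma>(1) by (intro measurable_restrict_space1 measurable_completion) simp
    show "Linf_norm (lebesgue_on {0<..}) \<gamma> \<le> ereal (4/3) * ?L"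
      unfolding Linf_norm_def M(1)[unfolded Linf_norm_def]
      using \<gamma>(2) meas by (intro esssup_I) auto
    fix x y :: real assume xy: "x \<noteq> y"
    then have "x - y \<noteq> 0" by simp
    note avg = grid_average[OF \<gamma>(1,2) xy rep[OF this]]
    show "AE (r, \<beta>) in dilation_measure \<Otimes>\<^sub>M shift_measure.
        (\<lambda>I. \<bar>grid_term \<gamma> x y I\<bar>) summable_on dyadic_grid r \<beta>" by (rule avg(1))
    show "integrable (dilation_measure \<Otimes>\<^sub>M shift_measure)
        (\<lambda>(r, \<beta>). \<Sum>\<^sub>\<infinity>I\<in>dyadic_grid r \<beta>. grid_term \<gamma> x y I)" by (rule avg(2))
    show "K (x - y) = (LINT \<beta>|shift_measure. LINT r|dilation_measure.
        (\<Sum>\<^sub>\<infinity>I\<in>dyadic_grid r \<beta>. grid_term \<gamma> x y I))" by (rule avg(3)[symmetric])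
  qed
qed

end
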